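(* For $k\ge2$, let $L_k$ be the following graph. Its vertices are $s_1,\dots,s_k$ together with three vertices $a_{ij},b_{ij},c_{ij}$ for every pair $1\le i<j\le k$. For each pair $i<j$, it has the edges $\{s_i,a_{ij}\},\{a_{ij},b_{ij}\},\{b_{ij},s_j\},\{s_j,c_{ij}\},\{c_{ij},s_i\}$ (so $s_i,a_{ij},b_{ij},s_j,c_{ij}$ form a 5-cycle); and for any two different pairs $\{i,j\}\ne\{l,m\}$, every vertex of $\{a_{ij},b_{ij},c_{ij}\}$ is adjacent to every vertex of $\{a_{lm},b_{lm},c_{lm}\}$. There are no other edges. Then for any $k\ge 2$: (i) $\nu\text{-rank}(L_k)\ge\alpha(L_k)-1$, i.e. $\nu^{(\alpha(L_k)-2)}(L_k)>\alpha(L_k)$. (ii) $\tilde\nu\text{-rank}(L_k)=1$.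
   Context: $\mathbb N=\{0,1,2,\dots\}$; $\alpha(G)$ is the maximum size of a stable (independent) set of $G$. $\mathcal S^n$ is the space of real symmetric $n\times n$ matrices. For $\beta\in\mathbb N^n$ put $|\beta|=\sum_i\beta_i$ and $x^\beta=x_1^{\beta_1}\cdots x_n^{\beta_n}$. For $n,r\in\mathbb N$: $\mathcal N_{n,r}$ is the set of homogeneous polynomials of degree $r$ in $x_1,\dots,x_n$ with nonnegative coefficients (including $0$); $\mathcal H_{n,r}$ is the cone of homogeneous polynomials of degree $r+2$ (including $0$) of the form $\sum_{\beta\in\mathbb N^n,\ |\beta|\in\{r,r+2\}}x^\beta\sigma_\beta$, where each $\sigma_\beta$ is a sum of squares of real polynomials of degree at most $r+2-|\beta|$. $\|p\|_1$ is the sum of the absolute values of the coefficients of $p$. Define $$\mathcal Q_n^{(r)}=\Big\{M\in\mathcal S^n:\Big(\sum_{i=1}^nx_i\Big)^r x^TMx\in\mathcal H_{n,r}\Big\},$$ $$\widetilde{\mathcal Q}_n^{(r)}=\{M\in\mathcal S^n:\ p\cdot x^TMx\in\mathcal H_{n,r}\text{ for some }p\in\mathcal N_{n,r}\text{ with }\|p\|_1=1\}.$$ For a graph $G$ on $n$ vertices with adjacency matrix $A_G$, with $I$ the identity and $J$ the all-ones $n\times n$ matrix, $\nu^{(r)}(G)=\min\{t\in\mathbb R: t(A_G+I)-J\in\mathcal Q_n^{(r)}\}$ and $\tilde\nu^{(r)}(G)=\min\{t\in\mathbb R: t(A_G+I)-J\in\widetilde{\mathcal Q}_n^{(r)}\}$.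 Further $\nu\text{-rank}(G)=\min\{r\in\mathbb N:\nu^{(r)}(G)=\alpha(G)\}$ and $\tilde\nu\text{-rank}(G)=\min\{r\in\mathbb N:\tilde\nu^{(r)}(G)=\alpha(G)\}$ (each equal to $+\infty$ if no such $r$ exists). *)

theory Defs
  imports Complex_Main "HOL-Library.Poly_Mapping" "HOL-Library.Extended_Nat"
begin

text \<open>
  Instead of the variables \<open>x_1, ..., x_n\<close>, polynomials have one variable \<open>x_v\<close> for each element
  \<open>v\<close> of a finite index set \<open>V\<close> (below: the vertex set of a graph), and matrices are indexed
  by \<open>V\<close> as well. A monomial is its exponent vector \<open>\<beta> :: 'v \<Rightarrow>\<^sub>0 nat\<close>; multiplication of
  polynomials is the convolution product of \<open>Poly_Mapping\<close>.
\<close>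

type_synonym 'v monom = "'v \<Rightarrow>\<^sub>0 nat"
type_synonym 'v rpoly = "'v monom \<Rightarrow>\<^sub>0 real"

definition mdeg :: "'v monom \<Rightarrow> nat" where
  "mdeg \<beta> = (\<Sum>v\<in>Poly_Mapping.keys \<beta>. Poly_Mapping.lookup \<beta> v)"

definition var :: "'v \<Rightarrow> 'v rpoly" where
  "var v = Poly_Mapping.single (Poly_Mapping.single v 1) 1"

definition mono_poly :: "'v monom \<Rightarrow> 'v rpoly" where
  "mono_poly \<beta> = Poly_Mapping.single \<beta> 1"

definition const_poly :: "real \<Rightarrow> 'v rpoly" where
  "const_poly c = Poly_Mapping.single 0 c"

definition poly_ring :: "'v set \<Rightarrow> 'v rpoly set" where
  "poly_ring V = {p. \<forall>\<beta>\<in>Poly_Mapping.keys p. Poly_Mapping.keys \<beta> \<subseteq> V}"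

definition deg_le :: "nat \<Rightarrow> 'v rpoly \<Rightarrow> bool" where
  "deg_le d p \<longleftrightarrow> (\<forall>\<beta>\<in>Poly_Mapping.keys p. mdeg \<beta> \<le> d)"

definition homogeneous :: "nat \<Rightarrow> 'v rpoly \<Rightarrow> bool" where
  "homogeneous d p \<longleftrightarrow> (\<forall>\<beta>\<in>Poly_Mapping.keys p. mdeg \<beta> = d)"

definition norm1 :: "'v rpoly \<Rightarrow> real" where
  "norm1 p = (\<Sum>\<beta>\<in>Poly_Mapping.keys p. \<bar>Poly_Mapping.lookup p \<beta>\<bar>)"

text \<open>The degree bound \<open>d\<close> refers to the polynomials that are squared.\<close>

definition sos :: "'v set \<Rightarrow> nat \<Rightarrow> 'v rpoly set" where
  "sos V d = {(\<Sum>q\<leftarrow>qs. q ^ 2) | qs. \<forall>q\<in>set qs. q \<in> poly_ring V \<and> deg_le d q}"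

definition cone_N :: "'v set \<Rightarrow> nat \<Rightarrow> 'v rpoly set" where
  "cone_N V r = {p \<in> poly_ring V. homogeneous r p \<and> (\<forall>\<beta>. Poly_Mapping.lookup p \<beta> \<ge> 0)}"

definition exponents :: "'v set \<Rightarrow> nat \<Rightarrow> 'v monom set" where
  "exponents V r = {\<beta>. Poly_Mapping.keys \<beta> \<subseteq> V \<and> mdeg \<beta> \<in> {r, r + 2}}"

definition cone_H :: "'v set \<Rightarrow> nat \<Rightarrow> 'v rpoly set" where
  "cone_H V r = {f \<in> poly_ring V. homogeneous (r + 2) f \<and>
     (\<exists>\<sigma>. (\<forall>\<beta>\<in>exponents V r. \<sigma> \<beta> \<in> sos V (r + 2 - mdeg \<beta>)) \<and>
          f = (\<Sum>\<beta>\<in>exponents V r. mono_poly \<beta> * \<sigma> \<beta>))}"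

type_synonym 'v mat = "'v \<Rightarrow> 'v \<Rightarrow> real"

definition sym_mat :: "'v set \<Rightarrow> 'v mat \<Rightarrow> bool" where
  "sym_mat V M \<longleftrightarrow> (\<forall>i\<in>V. \<forall>j\<in>V. M i j = M j i)"

definition quad_form :: "'v set \<Rightarrow> 'v mat \<Rightarrow> 'v rpoly" where
  "quad_form V M = (\<Sum>i\<in>V. \<Sum>j\<in>V. const_poly (M i j) * var i * var j)"

definition cone_Q :: "'v set \<Rightarrow> nat \<Rightarrow> 'v mat set" where
  "cone_Q V r = {M. sym_mat V M \<and> (\<Sum>i\<in>V. var i) ^ r * quad_form V M \<in> cone_H V r}"

definition cone_Q_tilde :: "'v set \<Rightarrow> nat \<Rightarrow> 'v mat set" where
  "cone_Q_tilde V r = {M. sym_mat V M \<and>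
     (\<exists>p\<in>cone_N V r. norm1 p = 1 \<and> p * quad_form V M \<in> cone_H V r)}"

text \<open>An edge is a set of two vertices.\<close>

record 'v ugraph =
  verts :: "'v set"
  edges :: "'v set set"

definition simple_graph :: "'v ugraph \<Rightarrow> bool" where
  "simple_graph G \<longleftrightarrow> finite (verts G) \<and> (\<forall>e\<in>edges G. e \<subseteq> verts G \<and> card e = 2)"

definition stable :: "'v ugraph \<Rightarrow> 'v set \<Rightarrow> bool" where
  "stable G S \<longleftrightarrow> S \<subseteq> verts G \<and> (\<forall>u\<in>S. \<forall>v\<in>S. {u, v} \<notin> edges G)"

definition alpha :: "'v ugraph \<Rightarrow> nat" where
  "alpha G = Max {card S | S. stable G S}"

definition adj_mat :: "'v ugraph \<Rightarrow> 'v mat" where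
  "adj_mat G = (\<lambda>u v. if {u, v} \<in> edges G then 1 else 0)"

definition id_mat :: "'v mat" where
  "id_mat = (\<lambda>u v. if u = v then 1 else 0)"

definition all_ones :: "'v mat" where
  "all_ones = (\<lambda>u v. 1)"

definition graph_mat :: "real \<Rightarrow> 'v ugraph \<Rightarrow> 'v mat" where
  "graph_mat t G = (\<lambda>u v. t * (adj_mat G u v + id_mat u v) - all_ones u v)"

text \<open>
  \<open>LEAST\<close> denotes the minimum: it is specified only if the minimum is attained. In particular,
  a strict lower bound on \<open>nu r G\<close> can only be derived once the minimum is known to exist.
\<close>

definition nu :: "nat \<Rightarrow> 'v ugraph \<Rightarrow> real" where
  "nu r G = (LEAST t. graph_mat t G \<in> cone_Q (verts G) r)"

definition nu_tilde :: "nat \<Rightarrow> 'v ugraph \<Rightarrow> real" where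
  "nu_tilde r G = (LEAST t. graph_mat t G \<in> cone_Q_tilde (verts G) r)"

text \<open>The infimum of a set of extended naturals is its minimum, and \<open>\<infinity>\<close> for the empty set.\<close>

definition nu_rank :: "'v ugraph \<Rightarrow> enat" where
  "nu_rank G = Inf {enat r | r. nu r G = real (alpha G)}"

definition nu_tilde_rank :: "'v ugraph \<Rightarrow> enat" where
  "nu_tilde_rank G = Inf {enat r | r. nu_tilde r G = real (alpha G)}"

datatype lvertex = VS nat | VA nat nat | VB nat nat | VC nat nat

definition L_pairs :: "nat \<Rightarrow> (nat \<times> nat) set" where
  "L_pairs k = {(i, j). 1 \<le> i \<and> i < j \<and> j \<le> k}"

definition L_block :: "nat \<Rightarrow> nat \<Rightarrow> lvertex set" where
  "L_block i j = {VA i j, VB i j, VC i j}"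

definition L_graph :: "nat \<Rightarrow> lvertex ugraph" where
  "L_graph k = \<lparr>
     verts = VS ` {1..k} \<union> (\<Union>(i, j)\<in>L_pairs k. L_block i j),
     edges =
       (\<Union>(i, j)\<in>L_pairs k.
          {{VS i, VA i j}, {VA i j, VB i j}, {VB i j, VS j}, {VS j, VC i j}, {VC i j, VS i}})
       \<union> {{u, w} | u w i j l m. (i, j) \<in> L_pairs k \<and> (l, m) \<in> L_pairs k \<and> (i, j) \<noteq> (l, m) \<and>
            u \<in> L_block i j \<and> w \<in> L_block l m}\<rparr>"

lemma finite_L_pairs: "finite (L_pairs k)"
  by (rule finite_subset[of _ "{1..k} \<times> {1..k}"]) (auto simp: L_pairs_def)

lemma verts_L_graph: "verts (L_graph k) = VS ` {1..k} \<union> (\<Union>(i, j)\<in>L_pairs k. L_block i j)"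
  by (simp add: L_graph_def)

lemma L_block_subset_verts: "(i, j) \<in> L_pairs k \<Longrightarrow> L_block i j \<subseteq> verts (L_graph k)"
  unfolding verts_L_graph by blast

lemma edges_L_graph_cases [consumes 1, case_names in_cycle joined]:
  assumes "e \<in> edges (L_graph k)"
  obtains i j where "(i, j) \<in> L_pairs k"
      "e \<in> {{VS i, VA i j}, {VA i j, VB i j}, {VB i j, VS j}, {VS j, VC i j}, {VC i j, VS i}}"
    | i j l m u w where "(i, j) \<in> L_pairs k" "(l, m) \<in> L_pairs k" "(i, j) \<noteq> (l, m)"
      "u \<in> L_block i j" "w \<in> L_block l m" "e = {u, w}"
proof -
  define P where "P i j =
    {{VS i, VA i j}, {VA i j, VB i j}, {VB i j, VS j}, {VS j, VC i j}, {VC i j, VS i}}" for i j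
  have "e \<in> (\<Union>(i, j)\<in>L_pairs k. P i j) \<or>
    (\<exists>u w i j l m. e = {u, w} \<and> (i, j) \<in> L_pairs k \<and> (l, m) \<in> L_pairs k \<and>
       (i, j) \<noteq> (l, m) \<and> u \<in> L_block i j \<and> w \<in> L_block l m)"
    using assms unfolding L_graph_def ugraph.simps Un_iff mem_Collect_eq P_def .
  then show thesis
  proof (elim disjE exE conjE)
    assume "e \<in> (\<Union>(i, j)\<in>L_pairs k. P i j)"
    then obtain i j where "(i, j) \<in> L_pairs k" "e \<in> P i j" by blast
    then show thesis using that(1) unfolding P_def by metis
  qed (rule that(2))
qed

lemma simple_graph_L_graph: "simple_graph (L_graph k)"
  unfolding simple_graph_def
proof (intro conjI ballI)
  show "finite (verts (L_graph k))"
    using finite_L_pairs by (auto simp: verts_L_graph L_block_def)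
next
  fix e assume "e \<in> edges (L_graph k)"
  then have "e \<subseteq> verts (L_graph k) \<and> card e = 2"
  proof (cases rule: edges_L_graph_cases)
    case (in_cycle i j)
    have "i \<in> {1..k}" "j \<in> {1..k}"
      using in_cycle(1) by (auto simp: L_pairs_def)
    then have "{VS i, VS j, VA i j, VB i j, VC i j} \<subseteq> verts (L_graph k)"
      using L_block_subset_verts[OF in_cycle(1)] by (simp add: verts_L_graph L_block_def)
    then show ?thesis
      using in_cycle(2) by (elim insertE emptyE) simp_all
  next
    case (joined i j l m u w)
    have "u \<noteq> w"
      using joined(3-5) by (auto simp: L_block_def)
    then show ?thesis
      using joined(4-6) L_block_subset_verts[OF joined(1)] L_block_subset_verts[OF joined(2)]
      by auto
  qed
  then show "e \<subseteq> verts (L_graph k)" "card e = 2" by auto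
qed

lemma finite_exponents:
  fixes V :: "'a set"
  assumes "finite V"
  shows "finite (exponents V r)"
proof (rule finite_subset)
  let ?F = "{f. \<forall>v. (v \<in> V \<longrightarrow> f v \<in> {..r + 2}) \<and> (v \<notin> V \<longrightarrow> f v = (0::nat))}"
  show "finite (Poly_Mapping.lookup -` ?F)"
  proof (rule finite_vimageI)
    show "finite ?F"
      by (rule finite_set_of_finite_funs) (simp_all add: assms)
    show "inj (Poly_Mapping.lookup :: 'a monom \<Rightarrow> _)"
      by (rule injI) (rule poly_mapping_eqI, simp)
  qed
  show "exponents V r \<subseteq> Poly_Mapping.lookup -` ?F"
  proof
    fix \<beta> assume b: "\<beta> \<in> exponents V r"
    have "Poly_Mapping.lookup \<beta> v \<le> r + 2" for v
    proof (cases "v \<in> Poly_Mapping.keys \<beta>")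
      case True
      then have "Poly_Mapping.lookup \<beta> v \<le> mdeg \<beta>"
        unfolding mdeg_def by (intro member_le_sum) auto
      then show ?thesis using b by (auto simp: exponents_def)
    next
      case False
      then show ?thesis by (simp add: in_keys_iff)
    qed
    moreover have "Poly_Mapping.lookup \<beta> v = 0" if "v \<notin> V" for v
    proof -
      have "v \<notin> Poly_Mapping.keys \<beta>" using b that by (auto simp: exponents_def)
      then show ?thesis by (simp add: in_keys_iff)
    qed
    ultimately show "\<beta> \<in> Poly_Mapping.lookup -` ?F" by simp
  qed
qed

end

theory Submission
  imports Defs "HOL-Analysis.Elementary_Metric_Spaces" "HOL-Analysis.Convex"
begin

text \<open>
  Write \<open>M = k (A + I) - J\<close> for the graph \<open>G = L_graph k\<close>, with vertex set \<open>V\<close>.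

  \<^bold>\<open>Gram representations.\<close> In an expression \<open>\<Sum>\<^sub>\<beta> x\<^sup>\<beta> \<sigma>\<^sub>\<beta>\<close> for a form of degree \<open>r + 2\<close>, the squares that
  go with \<open>\<bar>\<beta>\<bar> = r\<close> have no constant term, because the constant terms would show up in degree \<open>r\<close>.
  Only the linear parts matter then, and the cone consists of the forms \<open>f\<close> for which
  there are positive semidefinite matrices \<open>P\<^sub>\<beta>\<close>, \<open>\<bar>\<beta>\<bar> = r\<close>, such that \<open>f - \<Sum>\<^sub>\<beta> x\<^sup>\<beta> x\<^sup>T P\<^sub>\<beta> x\<close> has nonnegative
  coefficients (\<open>cone_H_imp_gram\<close>, \<open>gram_imp_cone_H\<close>). Everything else is argued with these \<open>P\<^sub>\<beta>\<close>. They are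
  bounded in terms of values of \<open>f\<close>, so the cone is closed (\<open>cone_H_closed\<close>) and the minimum that
  defines \<open>nu\<close> is attained (\<open>nu_attained\<close>). Moreover \<open>p x\<^sup>T N x\<close> in the cone forces \<open>N\<close> to be copositive, so
  that no admissible \<open>t\<close> is smaller than the size of a stable set. Strict inequality \<open>nu r G > alpha G\<close>
  thus means that \<open>alpha G (A + I) - J\<close> is not in \<open>cone_Q V r\<close> (\<open>alpha_less_nu\<close>).

  \<^bold>\<open>Lower bound.\<close> Let \<open>r \<le> k - 2\<close> and suppose that \<open>f = (\<Sum>x)\<^sup>r x\<^sup>T M x\<close> has a Gram representation. At the
  indicator vector of a stable set \<open>S\<close> of size \<open>k\<close> the form \<open>f\<close> vanishes, so this vector is in the kernel
  of \<open>P\<^sub>\<beta>\<close> whenever \<open>\<beta>\<close> is supported in \<open>S\<close>. For \<open>\<beta>\<close> supported in \<open>R = {s\<^sub>l. l \<noteq> i, j}\<close> this applies to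
  five sets: \<open>R\<close> together with any of the five nonadjacent pairs of the 5-cycle of the pair \<open>i, j\<close>.
  These pairs again form a cycle of odd length, so each vertex of it equals \<open>- R / 2\<close> modulo the kernel,
  and \<open>P\<^sub>\<beta> s\<^sub>i s\<^sub>j = R\<^sup>T P\<^sub>\<beta> R / 4 \<ge> 0\<close> (\<open>five_cycle_entry_nonneg\<close>). Only such entries contribute to
  the coefficient of \<open>s\<^sub>1 \<cdots> s\<^bsub>r+2\<^esub>\<close>, yet in \<open>f\<close> that coefficient is negative (\<open>L_graph_mat_notin_cone_Q\<close>).

  \<^bold>\<open>Upper bound.\<close> Partition \<open>V\<close> into \<open>k\<close> parts. The matrix with entry \<open>k - 1\<close> inside the parts and \<open>-1\<close>
  elsewhere is positive semidefinite by Cauchy-Schwarz, and it is below \<open>M\<close> if the parts are cliques.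
  There is no such clique cover of \<open>G\<close>, but for each vertex \<open>v\<close> of the form \<open>a\<^sub>i\<^sub>j\<close> or \<open>b\<^sub>i\<^sub>j\<close> there is a
  partition with few nonadjacent pairs inside its parts. In the sum \<open>p\<close> of the variables \<open>x\<^sub>v\<close>, the monomials
  with a negative coefficient which the partition of one \<open>v\<close> leaves behind are compensated by edges between
  the parts of the partition of another (\<open>part_defect_mixed\<close>). Hence \<open>p x\<^sup>T M x\<close> is in the cone of order 1
  (\<open>L_graph_mat_in_cone_Q_tilde_1\<close>). That also gives \<open>alpha G \<le> k\<close>. Order 0 is excluded by the lower bound, since
  the only normalized multiplier of degree 0 is 1.
\<close>

section \<open>Polynomials\<close>

subsection \<open>Exponents and coefficients\<close>

abbreviation coef :: "'v rpoly \<Rightarrow> 'v monom \<Rightarrow> real" where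
  "coef \<equiv> Poly_Mapping.lookup"

abbreviation unit_monom :: "'v \<Rightarrow> 'v monom" where
  "unit_monom v \<equiv> Poly_Mapping.single v 1"

lemma keys_eq_empty_nat: "Poly_Mapping.keys \<beta> = {} \<longleftrightarrow> \<beta> = 0" for \<beta> :: "'v monom"
proof
  assume "Poly_Mapping.keys \<beta> = {}"
  then have "Poly_Mapping.lookup \<beta> v = 0" for v
    by (auto simp flip: not_in_keys_iff_lookup_eq_zero)
  then show "\<beta> = 0" by (intro poly_mapping_eqI) simp
qed simp

text \<open>
  Degree as a sum over any common set of variables, so that degrees of different exponents can be added.
\<close>

lemma mdeg_superset:
  assumes "finite A" "Poly_Mapping.keys \<beta> \<subseteq> A"
  shows "mdeg \<beta> = (\<Sum>v\<in>A. Poly_Mapping.lookup \<beta> v)"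
  unfolding mdeg_def using assms by (intro sum.mono_neutral_left) (auto simp: in_keys_iff)

lemma keys_add_nat: "Poly_Mapping.keys (\<beta> + \<gamma> :: 'v monom) = Poly_Mapping.keys \<beta> \<union> Poly_Mapping.keys \<gamma>"
  by (auto simp: in_keys_iff lookup_add)

lemma mdeg_add [simp]: "mdeg (\<beta> + \<gamma>) = mdeg \<beta> + mdeg \<gamma>"
proof -
  let ?A = "Poly_Mapping.keys \<beta> \<union> Poly_Mapping.keys \<gamma>"
  have "mdeg (\<beta> + \<gamma>) = (\<Sum>v\<in>?A. Poly_Mapping.lookup (\<beta> + \<gamma>) v)"
    by (rule mdeg_superset) (auto simp: keys_add_nat)
  also have "\<dots> = mdeg \<beta> + mdeg \<gamma>"
    by (simp add: lookup_add sum.distrib mdeg_superset[of ?A])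
  finally show ?thesis .
qed

lemma mdeg_zero [simp]: "mdeg 0 = 0"
  by (simp add: mdeg_def)

lemma mdeg_single [simp]: "mdeg (Poly_Mapping.single v n) = n"
  by (simp add: mdeg_def)

lemma lookup_le_mdeg: "Poly_Mapping.lookup \<beta> v \<le> mdeg \<beta>"
proof (cases "v \<in> Poly_Mapping.keys \<beta>")
  case True
  then show ?thesis unfolding mdeg_def by (intro member_le_sum) auto
qed (simp add: in_keys_iff)

lemma mdeg_eq_0_iff: "mdeg \<beta> = 0 \<longleftrightarrow> \<beta> = 0"
proof
  assume "mdeg \<beta> = 0"
  then have "Poly_Mapping.lookup \<beta> v = 0" for v
    using lookup_le_mdeg[of \<beta> v] by simp
  then show "\<beta> = 0" by (intro poly_mapping_eqI) simp
qed simp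

lemma unit_monom_eq_iff [simp]:
  "Poly_Mapping.single v (Suc 0) = Poly_Mapping.single w (Suc 0) \<longleftrightarrow> v = w"
proof
  assume "Poly_Mapping.single v (Suc 0) = Poly_Mapping.single w (Suc 0)"
  then have "Poly_Mapping.keys (Poly_Mapping.single v (Suc 0)) = Poly_Mapping.keys (Poly_Mapping.single w (Suc 0))"
    by simp
  then show "v = w" by simp
qed simp

lemma monom_split_unit:
  assumes "v \<in> Poly_Mapping.keys \<beta>"
  obtains \<delta> where "\<beta> = \<delta> + unit_monom v"
proof
  show "\<beta> = (\<beta> - unit_monom v) + unit_monom v"
    using assms
    by (intro poly_mapping_eqI)
      (auto simp: lookup_add lookup_minus lookup_single when_def in_keys_iff)
qed

lemma mdeg_eq_1:
  assumes "mdeg \<beta> = 1"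
  obtains v where "\<beta> = unit_monom v"
proof -
  have "Poly_Mapping.keys \<beta> \<noteq> {}"
    using assms mdeg_def[of \<beta>] by auto
  then obtain v where "v \<in> Poly_Mapping.keys \<beta>" by blast
  then obtain \<delta> where d: "\<beta> = \<delta> + unit_monom v" by (rule monom_split_unit)
  then have "\<delta> = 0" using assms by (simp add: mdeg_eq_0_iff)
  then show thesis using d that by simp
qed

lemma poly_expand: "p = (\<Sum>\<beta>\<in>Poly_Mapping.keys p. Poly_Mapping.single \<beta> (coef p \<beta>))"
  for p :: "'v rpoly"
  by (intro poly_mapping_eqI)
    (auto simp: lookup_sum lookup_single when_def in_keys_iff sum.delta')

lemma poly_mult_expand:
  fixes p q :: "'v rpoly"
  shows "p * q = (\<Sum>\<beta>\<in>Poly_Mapping.keys p. \<Sum>\<gamma>\<in>Poly_Mapping.keys q.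
    Poly_Mapping.single (\<beta> + \<gamma>) (coef p \<beta> * coef q \<gamma>))"
proof -
  have "p * q = (\<Sum>\<beta>\<in>Poly_Mapping.keys p. Poly_Mapping.single \<beta> (coef p \<beta>)) *
      (\<Sum>\<gamma>\<in>Poly_Mapping.keys q. Poly_Mapping.single \<gamma> (coef q \<gamma>))"
    by (simp flip: poly_expand)
  then show ?thesis by (simp add: sum_product mult_single)
qed

lemma coef_mono_mult: "coef (mono_poly \<beta> * p) (\<beta> + \<delta>) = coef p \<delta>"
proof -
  have "mono_poly \<beta> * p = (\<Sum>\<gamma>\<in>Poly_Mapping.keys p. Poly_Mapping.single (\<beta> + \<gamma>) (coef p \<gamma>))"
    by (subst poly_expand[of p]) (simp add: sum_distrib_left mono_poly_def mult_single)
  then show ?thesis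
    by (auto simp: lookup_sum lookup_single when_def in_keys_iff sum.delta')
qed

lemma keys_mono_mult:
  "\<gamma> \<in> Poly_Mapping.keys (mono_poly \<beta> * p) \<Longrightarrow> \<exists>\<delta>\<in>Poly_Mapping.keys p. \<gamma> = \<beta> + \<delta>"
  using keys_mult[of "mono_poly \<beta>" p] by (auto simp: mono_poly_def split: if_splits)

lemma coef_mono_mult_0: "(\<And>\<delta>. \<gamma> \<noteq> \<beta> + \<delta>) \<Longrightarrow> coef (mono_poly \<beta> * p) \<gamma> = 0"
  using keys_mono_mult[of \<gamma> \<beta> p] by (auto simp: in_keys_iff)

lemma coef_const_mult [simp]: "coef (const_poly c * p) \<gamma> = c * coef p \<gamma>"
proof -
  have "const_poly c * p = (\<Sum>\<gamma>\<in>Poly_Mapping.keys p. Poly_Mapping.single \<gamma> (c * coef p \<gamma>))"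
    by (subst poly_expand[of p]) (simp add: sum_distrib_left const_poly_def mult_single)
  then show ?thesis
    by (auto simp: lookup_sum lookup_single when_def in_keys_iff sum.delta')
qed

lemma mono_poly_mult: "mono_poly \<beta> * mono_poly \<gamma> = mono_poly (\<beta> + \<gamma>)"
  by (simp add: mono_poly_def mult_single)

lemma const_poly_mult: "const_poly c * const_poly d = const_poly (c * d)"
  by (simp add: const_poly_def mult_single)

lemma const_poly_add: "const_poly c + const_poly d = const_poly (c + d)"
  by (simp add: const_poly_def single_add)

lemma const_poly_0 [simp]: "const_poly 0 = 0"
  by (simp add: const_poly_def)

lemma const_poly_1 [simp]: "const_poly 1 = 1"
  by (simp add: const_poly_def)

lemma var_eq_mono: "var v = mono_poly (unit_monom v)"
  by (simp add: var_def mono_poly_def)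

lemma mono_var_var:
  "mono_poly \<beta> * (var i * var j) = mono_poly (\<beta> + unit_monom i + unit_monom j)"
  by (simp add: var_eq_mono mono_poly_mult add.assoc)

lemma coef_mono: "coef (mono_poly \<beta>) \<gamma> = (if \<gamma> = \<beta> then 1 else 0)"
  by (auto simp: mono_poly_def lookup_single when_def)

lemma coef_const: "coef (const_poly c) \<gamma> = (if \<gamma> = 0 then c else 0)"
  by (auto simp: const_poly_def lookup_single when_def)

subsection \<open>The polynomial ring over a set of variables\<close>

lemma poly_ring_0: "0 \<in> poly_ring V"
  by (simp add: poly_ring_def)

lemma poly_ring_add: "p \<in> poly_ring V \<Longrightarrow> q \<in> poly_ring V \<Longrightarrow> p + q \<in> poly_ring V"
  unfolding poly_ring_def using keys_add[of p q] by blast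

lemma poly_ring_mult: "p \<in> poly_ring V \<Longrightarrow> q \<in> poly_ring V \<Longrightarrow> p * q \<in> poly_ring V"
  unfolding poly_ring_def using keys_mult[of p q] by (fastforce simp: keys_add_nat)

lemma poly_ring_mono: "Poly_Mapping.keys \<beta> \<subseteq> V \<Longrightarrow> mono_poly \<beta> \<in> poly_ring V"
  by (simp add: poly_ring_def mono_poly_def)

lemma poly_ring_const: "const_poly c \<in> poly_ring V"
  by (simp add: poly_ring_def const_poly_def)

lemma poly_ring_var: "v \<in> V \<Longrightarrow> var v \<in> poly_ring V"
  by (simp add: poly_ring_def var_def)

lemma poly_ring_sum: "(\<And>a. a \<in> A \<Longrightarrow> p a \<in> poly_ring V) \<Longrightarrow> sum p A \<in> poly_ring V"
  by (induction A rule: infinite_finite_induct) (auto intro: poly_ring_0 poly_ring_add)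

lemma poly_ring_power: "p \<in> poly_ring V \<Longrightarrow> p ^ n \<in> poly_ring V"
  by (induction n) (auto intro: poly_ring_mult poly_ring_const[of 1, simplified])

lemmas poly_ring_intros = poly_ring_0 poly_ring_add poly_ring_mult poly_ring_mono
  poly_ring_const poly_ring_var poly_ring_sum poly_ring_power

subsection \<open>Homogeneous polynomials, and polynomials without terms of low degree\<close>

lemma homogeneous_0: "homogeneous d 0"
  by (simp add: homogeneous_def)

lemma homogeneous_add: "homogeneous d p \<Longrightarrow> homogeneous d q \<Longrightarrow> homogeneous d (p + q)"
  unfolding homogeneous_def using keys_add[of p q] by blast

lemma homogeneous_mult:
  "homogeneous d p \<Longrightarrow> homogeneous e q \<Longrightarrow> homogeneous (d + e) (p * q)"
  unfolding homogeneous_def using keys_mult[of p q] by fastforce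

lemma homogeneous_const: "homogeneous 0 (const_poly c)"
  by (simp add: homogeneous_def const_poly_def)

lemma homogeneous_var: "homogeneous 1 (var v)"
  by (simp add: homogeneous_def var_def)

lemma homogeneous_mono: "homogeneous (mdeg \<beta>) (mono_poly \<beta>)"
  by (simp add: homogeneous_def mono_poly_def)

lemma homogeneous_sum: "(\<And>a. a \<in> A \<Longrightarrow> homogeneous d (p a)) \<Longrightarrow> homogeneous d (sum p A)"
  by (induction A rule: infinite_finite_induct) (auto intro: homogeneous_0 homogeneous_add)

lemma homogeneous_power: "homogeneous 1 p \<Longrightarrow> homogeneous n (p ^ n)"
  using homogeneous_mult[of 1 p] by (induction n) (auto simp: homogeneous_const[of 1, simplified])

lemma coef_homogeneous: "homogeneous d p \<Longrightarrow> mdeg \<gamma> \<noteq> d \<Longrightarrow> coef p \<gamma> = 0"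
  by (auto simp: homogeneous_def in_keys_iff)

text \<open>
  Needed for polynomials all of whose terms have too large a degree to influence a given coefficient.
\<close>

definition min_deg :: "nat \<Rightarrow> 'v rpoly \<Rightarrow> bool" where
  "min_deg d p \<longleftrightarrow> (\<forall>\<beta>\<in>Poly_Mapping.keys p. mdeg \<beta> \<ge> d)"

lemma min_deg_add: "min_deg d p \<Longrightarrow> min_deg d q \<Longrightarrow> min_deg d (p + q)"
  unfolding min_deg_def using keys_add[of p q] by blast

lemma min_deg_mult: "min_deg d p \<Longrightarrow> min_deg e q \<Longrightarrow> min_deg (d + e) (p * q)"
  unfolding min_deg_def using keys_mult[of p q] by (fastforce intro: add_mono)

lemma min_deg_antimono: "min_deg d p \<Longrightarrow> e \<le> d \<Longrightarrow> min_deg e p"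
  unfolding min_deg_def by fastforce

lemma homogeneous_min_deg: "homogeneous d p \<Longrightarrow> min_deg d p"
  by (simp add: min_deg_def homogeneous_def)

lemma coef_min_deg: "min_deg d p \<Longrightarrow> mdeg \<gamma> < d \<Longrightarrow> coef p \<gamma> = 0"
  by (force simp: min_deg_def in_keys_iff)

subsection \<open>Nonnegative coefficients\<close>

definition nonneg_coefs :: "'v rpoly \<Rightarrow> bool" where
  "nonneg_coefs p \<longleftrightarrow> (\<forall>\<beta>. 0 \<le> coef p \<beta>)"

lemma nonneg_coefs_0: "nonneg_coefs 0"
  by (simp add: nonneg_coefs_def)

lemma nonneg_coefs_add: "nonneg_coefs p \<Longrightarrow> nonneg_coefs q \<Longrightarrow> nonneg_coefs (p + q)"
  by (simp add: nonneg_coefs_def lookup_add)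

lemma nonneg_coefs_sum: "(\<And>a. a \<in> A \<Longrightarrow> nonneg_coefs (p a)) \<Longrightarrow> nonneg_coefs (sum p A)"
  by (induction A rule: infinite_finite_induct) (auto intro: nonneg_coefs_add nonneg_coefs_0)

lemma nonneg_coefs_const: "c \<ge> 0 \<Longrightarrow> nonneg_coefs (const_poly c)"
  by (simp add: nonneg_coefs_def coef_const)

lemma nonneg_coefs_mono: "nonneg_coefs (mono_poly \<beta>)"
  by (simp add: nonneg_coefs_def coef_mono)

lemma nonneg_coefs_var: "nonneg_coefs (var v)"
  by (simp add: var_eq_mono nonneg_coefs_mono)

lemma nonneg_coefs_mult:
  assumes "nonneg_coefs p" "nonneg_coefs q"
  shows "nonneg_coefs (p * q)"
proof -
  have "nonneg_coefs (\<Sum>\<beta>\<in>Poly_Mapping.keys p. \<Sum>\<gamma>\<in>Poly_Mapping.keys q.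
      Poly_Mapping.single (\<beta> + \<gamma>) (coef p \<beta> * coef q \<gamma>))"
    using assms by (intro nonneg_coefs_sum) (simp add: nonneg_coefs_def lookup_single when_def)
  then show ?thesis by (simp flip: poly_mult_expand)
qed

lemma nonneg_coefs_power: "nonneg_coefs p \<Longrightarrow> nonneg_coefs (p ^ n)"
  by (induction n) (auto intro: nonneg_coefs_mult nonneg_coefs_const[of 1, simplified])

subsection \<open>Evaluation\<close>

definition monom_val :: "('v \<Rightarrow> real) \<Rightarrow> 'v monom \<Rightarrow> real" where
  "monom_val x \<beta> = (\<Prod>v\<in>Poly_Mapping.keys \<beta>. x v ^ Poly_Mapping.lookup \<beta> v)"

definition poly_val :: "('v \<Rightarrow> real) \<Rightarrow> 'v rpoly \<Rightarrow> real" where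
  "poly_val x p = (\<Sum>\<beta>\<in>Poly_Mapping.keys p. coef p \<beta> * monom_val x \<beta>)"

lemma monom_val_superset:
  assumes "finite A" "Poly_Mapping.keys \<beta> \<subseteq> A"
  shows "monom_val x \<beta> = (\<Prod>v\<in>A. x v ^ Poly_Mapping.lookup \<beta> v)"
  unfolding monom_val_def using assms by (intro prod.mono_neutral_left) (auto simp: in_keys_iff)

lemma monom_val_add: "monom_val x (\<beta> + \<gamma>) = monom_val x \<beta> * monom_val x \<gamma>"
proof -
  let ?A = "Poly_Mapping.keys \<beta> \<union> Poly_Mapping.keys \<gamma>"
  have "monom_val x (\<beta> + \<gamma>) = (\<Prod>v\<in>?A. x v ^ Poly_Mapping.lookup (\<beta> + \<gamma>) v)"
    by (rule monom_val_superset) (auto simp: keys_add_nat)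
  also have "\<dots> = monom_val x \<beta> * monom_val x \<gamma>"
    by (simp add: lookup_add power_add prod.distrib monom_val_superset[of ?A])
  finally show ?thesis .
qed

lemma poly_val_superset:
  assumes "finite A" "Poly_Mapping.keys p \<subseteq> A"
  shows "poly_val x p = (\<Sum>\<beta>\<in>A. coef p \<beta> * monom_val x \<beta>)"
  unfolding poly_val_def using assms by (intro sum.mono_neutral_left) (auto simp: in_keys_iff)

lemma poly_val_add: "poly_val x (p + q) = poly_val x p + poly_val x q"
proof -
  let ?A = "Poly_Mapping.keys p \<union> Poly_Mapping.keys q"
  have "poly_val x (p + q) = (\<Sum>\<beta>\<in>?A. coef (p + q) \<beta> * monom_val x \<beta>)"
    using keys_add[of p q] by (intro poly_val_superset) auto
  also have "\<dots> = poly_val x p + poly_val x q"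
    by (simp add: lookup_add algebra_simps sum.distrib poly_val_superset[of ?A])
  finally show ?thesis .
qed

lemma poly_val_0 [simp]: "poly_val x 0 = 0"
  by (simp add: poly_val_def)

lemma poly_val_sum: "poly_val x (sum p A) = (\<Sum>a\<in>A. poly_val x (p a))"
  by (induction A rule: infinite_finite_induct) (auto simp: poly_val_add)

lemma poly_val_single: "poly_val x (Poly_Mapping.single \<beta> c) = c * monom_val x \<beta>"
  by (simp add: poly_val_def)

lemma poly_val_mult: "poly_val x (p * q) = poly_val x p * poly_val x q"
proof -
  have "poly_val x (p * q) = (\<Sum>\<beta>\<in>Poly_Mapping.keys p. \<Sum>\<gamma>\<in>Poly_Mapping.keys q.
      coef p \<beta> * coef q \<gamma> * (monom_val x \<beta> * monom_val x \<gamma>))"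
    by (simp add: poly_mult_expand poly_val_sum poly_val_single monom_val_add)
  also have "\<dots> = poly_val x p * poly_val x q"
    by (simp add: poly_val_def sum_product algebra_simps)
  finally show ?thesis .
qed

lemma poly_val_const [simp]: "poly_val x (const_poly c) = c"
  by (simp add: const_poly_def poly_val_single monom_val_def)

lemma poly_val_1 [simp]: "poly_val x 1 = 1"
  using poly_val_const[of x 1] by simp

lemma poly_val_power: "poly_val x (p ^ n) = poly_val x p ^ n"
  by (induction n) (auto simp: poly_val_mult)

lemma poly_val_var [simp]: "poly_val x (var v) = x v"
  by (simp add: var_def poly_val_single monom_val_def)

lemma poly_val_mono [simp]: "poly_val x (mono_poly \<beta>) = monom_val x \<beta>"
  by (simp add: mono_poly_def poly_val_single)

lemma monom_val_nonneg:
  assumes "\<And>v. v \<in> Poly_Mapping.keys \<beta> \<Longrightarrow> x v \<ge> 0" shows "monom_val x \<beta> \<ge> 0"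
  unfolding monom_val_def using assms by (intro prod_nonneg) auto

lemma poly_val_mono_coefs:
  assumes "\<And>v. x v \<ge> 0" "\<And>\<gamma>. coef p \<gamma> \<le> coef q \<gamma>"
  shows "poly_val x p \<le> poly_val x q"
proof -
  let ?A = "Poly_Mapping.keys p \<union> Poly_Mapping.keys q"
  show ?thesis
    unfolding poly_val_superset[of ?A p, OF _ Un_upper1, simplified]
      poly_val_superset[of ?A q, OF _ Un_upper2, simplified]
    using assms by (intro sum_mono mult_right_mono monom_val_nonneg) auto
qed

lemma norm1_eq_poly_val: "nonneg_coefs p \<Longrightarrow> norm1 p = poly_val (\<lambda>_. 1) p"
  by (simp add: norm1_def poly_val_def monom_val_def nonneg_coefs_def)

section \<open>Quadratic forms\<close>

definition quad_val :: "'v set \<Rightarrow> 'v mat \<Rightarrow> ('v \<Rightarrow> real) \<Rightarrow> real" where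
  "quad_val V P x = (\<Sum>i\<in>V. \<Sum>j\<in>V. P i j * x i * x j)"

definition psd :: "'v set \<Rightarrow> 'v mat \<Rightarrow> bool" where
  "psd V P \<longleftrightarrow> sym_mat V P \<and> (\<forall>x. 0 \<le> quad_val V P x)"

definition lin_form :: "'v set \<Rightarrow> ('v \<Rightarrow> real) \<Rightarrow> 'v rpoly" where
  "lin_form V l = (\<Sum>i\<in>V. const_poly (l i) * var i)"

lemma poly_val_quad_form: "poly_val x (quad_form V M) = quad_val V M x"
  by (simp add: quad_form_def poly_val_sum poly_val_mult quad_val_def)

lemma quad_form_cong: "(\<And>i j. i \<in> V \<Longrightarrow> j \<in> V \<Longrightarrow> M i j = N i j) \<Longrightarrow> quad_form V M = quad_form V N"
  unfolding quad_form_def by (intro sum.cong refl) simp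

lemma quad_form_add: "quad_form V (\<lambda>i j. M i j + N i j) = quad_form V M + quad_form V N"
  by (simp add: quad_form_def sum.distrib algebra_simps flip: const_poly_add)

lemma quad_form_scale: "quad_form V (\<lambda>i j. c * M i j) = const_poly c * quad_form V M"
  by (simp add: quad_form_def sum_distrib_left algebra_simps flip: const_poly_mult)

lemma quad_form_0: "quad_form V (\<lambda>i j. 0) = 0"
  by (simp add: quad_form_def)

lemma lin_form_square: "lin_form V l ^ 2 = quad_form V (\<lambda>i j. l i * l j)"
  by (simp add: lin_form_def quad_form_def power2_eq_square sum_product algebra_simps flip: const_poly_mult)

lemma quad_form_sum_list:
  "quad_form V (\<lambda>i j. \<Sum>l\<leftarrow>ls. l i * l j) = (\<Sum>l\<leftarrow>ls. lin_form V l ^ 2)"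
  by (induction ls) (simp_all add: quad_form_add quad_form_0 lin_form_square)

lemma quad_form_in_ring: "quad_form V M \<in> poly_ring V"
  unfolding quad_form_def by (intro poly_ring_intros)

lemma homogeneous_quad_form: "homogeneous 2 (quad_form V M)"
proof -
  have "homogeneous (0 + 1 + 1) (const_poly c * var i * var j)" for c and i j :: 'a
    by (intro homogeneous_mult homogeneous_const homogeneous_var)
  then show ?thesis
    unfolding quad_form_def by (intro homogeneous_sum) (simp add: numeral_2_eq_2)
qed

lemma lin_form_in_ring: "lin_form V l \<in> poly_ring V"
  unfolding lin_form_def by (intro poly_ring_intros)

lemma homogeneous_lin_form: "homogeneous 1 (lin_form V l)"
proof -
  have "homogeneous (0 + 1) (const_poly c * var i)" for c and i :: 'a
    by (intro homogeneous_mult homogeneous_const homogeneous_var)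
  then show ?thesis
    unfolding lin_form_def by (intro homogeneous_sum) simp
qed

lemma nonneg_coefs_quad_form:
  "(\<And>i j. i \<in> V \<Longrightarrow> j \<in> V \<Longrightarrow> M i j \<ge> 0) \<Longrightarrow> nonneg_coefs (quad_form V M)"
  unfolding quad_form_def
  by (intro nonneg_coefs_sum nonneg_coefs_mult nonneg_coefs_const nonneg_coefs_var)

lemma coef_lin_form:
  assumes "finite V"
  shows "coef (lin_form V l) (unit_monom v) = (if v \<in> V then l v else 0)"
proof -
  have "coef (lin_form V l) (unit_monom v) = (\<Sum>i\<in>V. if i = v then l i else 0)"
    unfolding lin_form_def lookup_sum var_eq_mono
    by (intro sum.cong) (auto simp: coef_mono)
  then show ?thesis using assms by (simp add: sum.delta)
qed

lemma quad_val_add: "quad_val V (\<lambda>i j. M i j + N i j) x = quad_val V M x + quad_val V N x"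
  by (simp add: quad_val_def algebra_simps sum.distrib)

lemma quad_val_scale: "quad_val V (\<lambda>i j. c * M i j) x = c * quad_val V M x"
  by (simp add: quad_val_def algebra_simps sum_distrib_left)

lemma quad_val_rank_one: "quad_val V (\<lambda>i j. l i * l j) x = (\<Sum>i\<in>V. l i * x i)\<^sup>2"
  by (simp add: quad_val_def power2_eq_square sum_product algebra_simps)

lemma psd_0: "psd V (\<lambda>i j. 0)"
  by (simp add: psd_def sym_mat_def quad_val_def)

lemma psd_add: "psd V M \<Longrightarrow> psd V N \<Longrightarrow> psd V (\<lambda>i j. M i j + N i j)"
  unfolding psd_def quad_val_add sym_mat_def by simp

lemma psd_scale: "c \<ge> 0 \<Longrightarrow> psd V M \<Longrightarrow> psd V (\<lambda>i j. c * M i j)"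
  unfolding psd_def quad_val_scale sym_mat_def by simp

lemma psd_rank_one: "psd V (\<lambda>i j. l i * l j)"
  by (simp add: psd_def sym_mat_def quad_val_rank_one)

lemma psd_sum_list: "psd V (\<lambda>i j. \<Sum>l\<leftarrow>ls. l i * l j)"
  by (induction ls) (simp_all add: psd_0 psd_add psd_rank_one)

definition bilin :: "'v set \<Rightarrow> 'v mat \<Rightarrow> ('v \<Rightarrow> real) \<Rightarrow> ('v \<Rightarrow> real) \<Rightarrow> real" where
  "bilin V P x y = (\<Sum>i\<in>V. \<Sum>j\<in>V. P i j * x i * y j)"

lemma bilin_self: "bilin V P x x = quad_val V P x"
  by (simp add: bilin_def quad_val_def)

lemma bilin_add_left: "bilin V P (\<lambda>v. x v + y v) z = bilin V P x z + bilin V P y z"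
  by (simp add: bilin_def algebra_simps sum.distrib)

lemma bilin_scale_left: "bilin V P (\<lambda>v. c * x v) z = c * bilin V P x z"
  by (simp add: bilin_def algebra_simps sum_distrib_left)

lemma bilin_commute: "sym_mat V P \<Longrightarrow> bilin V P x y = bilin V P y x"
  unfolding bilin_def
  by (subst sum.swap) (auto intro!: sum.cong simp: sym_mat_def)

lemma bilin_unit:
  assumes "finite V" "a \<in> V" "b \<in> V"
  shows "bilin V P (indicator {a}) (indicator {b}) = P a b"
proof -
  have "bilin V P (indicator {a}) (indicator {b}) = (\<Sum>i\<in>V. if i = a then (\<Sum>j\<in>V. if j = b then P i j else 0) else 0)"
    unfolding bilin_def by (intro sum.cong) (auto intro!: sum.cong simp: indicator_def)
  then show ?thesis using assms by (simp add: sum.delta)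
qed

lemma quad_val_unit: "finite V \<Longrightarrow> a \<in> V \<Longrightarrow> quad_val V P (indicator {a}) = P a a"
  by (simp add: bilin_unit flip: bilin_self)

lemma quad_val_line:
  assumes "sym_mat V P"
  shows "quad_val V P (\<lambda>v. x v + t * y v) = quad_val V P x + 2 * t * bilin V P x y + t\<^sup>2 * quad_val V P y"
proof -
  have sc: "bilin V P u (\<lambda>v. x v + t * y v) = bilin V P u x + t * bilin V P u y" for u
    using bilin_add_left[of V P x "\<lambda>v. t * y v" u] bilin_scale_left[of V P t y u]
    by (simp add: bilin_commute[OF assms, of u])
  have "quad_val V P (\<lambda>v. x v + t * y v) = bilin V P x (\<lambda>v. x v + t * y v) + t * bilin V P y (\<lambda>v. x v + t * y v)"
    using bilin_add_left[of V P x "\<lambda>v. t * y v"] bilin_scale_left[of V P t y] by (simp add: bilin_self[symmetric])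
  then show ?thesis
    unfolding sc using bilin_commute[OF assms, of y x]
    by (simp add: bilin_self power2_eq_square algebra_simps)
qed

text \<open>
  A positive semidefinite form satisfies \<open>0 \<le> P(y + t x) = P(y) + 2 t P(x, y)\<close> for all \<open>t\<close>
  when \<open>P(x) = 0\<close>; an affine function that is bounded below is constant.
\<close>

lemma psd_kernel:
  assumes "psd V P" "quad_val V P x = 0"
  shows "bilin V P x y = 0"
proof (rule ccontr)
  assume b: "bilin V P x y \<noteq> 0"
  have "0 \<le> quad_val V P (\<lambda>v. y v + t * x v)" for t
    using assms(1) by (simp add: psd_def)
  then have "0 \<le> quad_val V P y + 2 * t * bilin V P x y" for t
    using assms bilin_commute[of V P x y] by (simp add: quad_val_line psd_def)
  \<comment> \<open>At this argument the affine function takes the value -1.\<close>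
  from this[of "- (quad_val V P y + 1) / (2 * bilin V P x y)"] show False
    using b by (simp add: field_simps)
qed

lemma psd_diag_nonneg: "finite V \<Longrightarrow> psd V P \<Longrightarrow> a \<in> V \<Longrightarrow> 0 \<le> P a a"
  using quad_val_unit[of V a P] by (metis psd_def)

lemma psd_entry_bound:
  assumes "finite V" "psd V P" "a \<in> V" "b \<in> V"
  shows "2 * \<bar>P a b\<bar> \<le> P a a + P b b"
proof -
  have s: "sym_mat V P" using assms(2) by (simp add: psd_def)
  have "0 \<le> quad_val V P (\<lambda>v. indicator {a} v + t * indicator {b} v)" for t
    using assms(2) by (simp add: psd_def)
  then have "0 \<le> P a a + 2 * t * P a b + t\<^sup>2 * P b b" for t
    unfolding quad_val_line[OF s] by (simp add: assms bilin_unit quad_val_unit)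
  from this[of 1] this[of "-1"] show ?thesis by (simp add: abs_le_iff)
qed

text \<open>
  Completion of the square, one variable after the other: the Schur complement \<open>Q\<close> of the diagonal entry
  \<open>P a a\<close> is again positive semidefinite, because the value of \<open>Q\<close> at \<open>x\<close> is the minimum of the value
  of \<open>P\<close> over all choices of the coordinate \<open>a\<close>. If \<open>P a a = 0\<close>, the row of \<open>a\<close> vanishes and division
  by zero, which yields zero, makes the same formulas correct.
\<close>

lemma psd_imp_sum_of_squares:
  assumes "finite V" "psd V P"
  shows "\<exists>ls :: ('v \<Rightarrow> real) list. \<forall>i\<in>V. \<forall>j\<in>V. P i j = (\<Sum>l\<leftarrow>ls. l i * l j)"
  using assms
proof (induction V arbitrary: P rule: finite_induct)
  case empty
  show ?case by simp
next
  case (insert a V)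
  let ?W = "insert a V"
  have sym: "P i j = P j i" if "i \<in> ?W" "j \<in> ?W" for i j
    using insert.prems that unfolding psd_def sym_mat_def by blast
  define Q where "Q i j = P i j - P i a * P a j / P a a" for i j
  have finW: "finite ?W" using insert.hyps by simp
  have zero: "P a i = 0" if "P a a = 0" "i \<in> ?W" for i
  proof -
    have "quad_val ?W P (indicator {a}) = 0"
      using that finW by (simp add: quad_val_unit)
    from psd_kernel[OF insert.prems this, of "indicator {i}"] show ?thesis
      using bilin_unit[OF finW, of a i P] that by simp
  qed
  have "psd V Q"
  proof -
    have "quad_val V Q x \<ge> 0" for x
    proof -
      define s where "s = (\<Sum>i\<in>V. P a i * x i)"
      define y where "y v = (if v = a then - s / P a a else x v)" for v
      have ya: "y v = x v" if "v \<in> V" for v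
        using that insert.hyps by (auto simp: y_def)
      have s': "(\<Sum>i\<in>V. P i a * x i) = s"
        unfolding s_def by (intro sum.cong) (auto simp: sym)
      have 1: "(\<Sum>j\<in>V. P a j * y a * y j) = y a * s"
        by (simp add: s_def ya sum_distrib_left mult_ac)
      have 2: "(\<Sum>i\<in>V. P i a * y i * y a) = y a * s"
        by (simp add: ya sum_distrib_left mult_ac flip: s')
      have "quad_val ?W P y = P a a * (y a)\<^sup>2 + 2 * y a * s + quad_val V P x"
        using insert.hyps 1 2
        by (simp add: quad_val_def sum.distrib ya power2_eq_square)
      also have "\<dots> = quad_val V P x - s\<^sup>2 / P a a"
        by (cases "P a a = 0") (auto simp: y_def field_simps power2_eq_square)
      also have "\<dots> = quad_val V Q x"
      proof -
        have "quad_val V (\<lambda>i j. - (P i a * P a j / P a a)) x = - ((\<Sum>i\<in>V. P i a * x i) * (\<Sum>j\<in>V. P a j * x j) / P a a)"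
          unfolding sum_product
          by (simp add: quad_val_def sum_negf sum_divide_distrib mult_ac)
        then show ?thesis
          unfolding Q_def using quad_val_add[of V P "\<lambda>i j. - (P i a * P a j / P a a)" x]
          by (simp add: s' power2_eq_square flip: s_def)
      qed
      finally show ?thesis using insert.prems unfolding psd_def by metis
    qed
    then show ?thesis
      unfolding psd_def sym_mat_def by (auto simp: Q_def sym)
  qed
  from insert.IH[OF this] obtain ls where
    ls: "\<forall>i\<in>V. \<forall>j\<in>V. Q i j = (\<Sum>l\<leftarrow>ls. l i * l j)" by blast
  define ls' where "ls' = (\<lambda>v. P v a / sqrt (P a a)) # map (\<lambda>l. l(a := 0)) ls"
  have "P i j = (\<Sum>l\<leftarrow>ls'. l i * l j)" if "i \<in> ?W" "j \<in> ?W" for i j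
  proof -
    have nn: "P a a \<ge> 0" using psd_diag_nonneg[OF finW insert.prems] by simp
    have *: "(\<Sum>l\<leftarrow>map (\<lambda>l. l(a := 0)) ls. l i * l j) = Q i j"
    proof (cases "i = a \<or> j = a")
      case True
      have "(\<Sum>l\<leftarrow>map (\<lambda>l. l(a := 0)) ls. l i * l j) = 0"
        using True by (induction ls) auto
      moreover have "Q i j = 0"
        using True zero[of i] zero[of j] that sym[of i a] by (auto simp: Q_def)
      ultimately show ?thesis by simp
    next
      case False
      then show ?thesis using ls that by (simp add: o_def)
    qed
    have "(\<Sum>l\<leftarrow>ls'. l i * l j) = P i a * P j a / (sqrt (P a a) * sqrt (P a a)) + Q i j"
      unfolding ls'_def using * by simp
    also have "\<dots> = P i j"
      using nn that sym[of j a] by (simp add: Q_def)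
    finally show ?thesis by simp
  qed
  then show ?case by blast
qed

lemma quad_val_sum:
  "quad_val V (\<lambda>i j. \<Sum>m\<in>K. N m i j) x = (\<Sum>m\<in>K. quad_val V (N m) x)"
  by (induction K rule: infinite_finite_induct)
    (simp_all add: quad_val_add, simp_all add: quad_val_def)

text \<open>
  With \<open>y m\<close> the sum of \<open>x\<close> over the part \<open>m\<close>, the value of this matrix at \<open>x\<close> is
  \<open>card K (\<Sum>m. (y m)\<^sup>2) - (\<Sum>m. y m)\<^sup>2\<close>, which is nonnegative by Cauchy-Schwarz.
\<close>

lemma psd_partition:
  assumes V: "finite V" and K: "finite K" and part: "\<And>v. v \<in> V \<Longrightarrow> part v \<in> K"
  shows "psd V (\<lambda>i j. real (card K) * (if part i = part j then 1 else 0) - 1)"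
proof -
  define e where "e m i = (if part i = m then 1 else 0 :: real)" for m i
  have "quad_val V (\<lambda>i j. real (card K) * (if part i = part j then 1 else 0) - 1) x \<ge> 0" for x
  proof -
    define y where "y m = (\<Sum>i\<in>V. e m i * x i)" for m
    have "(if part i = part j then 1 else 0) = (\<Sum>m\<in>K. e m i * e m j)" if "i \<in> V" for i j
      using K part[OF that] by (simp add: e_def if_distrib[where f="\<lambda>c. c * _"] sum.delta cong: if_cong)
    then have "quad_val V (\<lambda>i j. real (card K) * (if part i = part j then 1 else 0) - 1) x =
        quad_val V (\<lambda>i j. real (card K) * (\<Sum>m\<in>K. e m i * e m j) + (-1) * (1 * 1)) x"
      unfolding quad_val_def by (intro sum.cong) auto
    also have "\<dots> = real (card K) * (\<Sum>m\<in>K. (y m)\<^sup>2) - (\<Sum>i\<in>V. x i)\<^sup>2"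
      using quad_val_rank_one[of V "\<lambda>_. 1" x]
      unfolding quad_val_add quad_val_scale quad_val_sum quad_val_rank_one y_def by simp
    also have "(\<Sum>i\<in>V. x i) = (\<Sum>m\<in>K. y m)"
    proof -
      have "(\<Sum>m\<in>K. y m) = (\<Sum>i\<in>V. \<Sum>m\<in>K. e m i * x i)"
        unfolding y_def by (rule sum.swap)
      also have "\<dots> = (\<Sum>i\<in>V. x i)"
        using K part by (intro sum.cong) (auto simp: e_def if_distrib[where f="\<lambda>c. c * _"] sum.delta cong: if_cong)
      finally show ?thesis by simp
    qed
    also have "real (card K) * (\<Sum>m\<in>K. (y m)\<^sup>2) - (\<Sum>m\<in>K. y m)\<^sup>2 \<ge> 0"
      using sum_squared_le_sum_of_squares[of y K] by (simp add: mult.commute)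
    finally show ?thesis .
  qed
  then show ?thesis unfolding psd_def by (simp add: sym_mat_def)
qed

section \<open>Gram representations of the cone\<close>

definition monoms :: "'v set \<Rightarrow> nat \<Rightarrow> 'v monom set" where
  "monoms V r = {\<beta>. Poly_Mapping.keys \<beta> \<subseteq> V \<and> mdeg \<beta> = r}"

text \<open>
  The polynomial \<open>\<Sum>\<^sub>\<beta> x\<^sup>\<beta> x\<^sup>T P\<^sub>\<beta> x\<close>. The terms of the cone with \<open>\<bar>\<beta>\<bar> = r + 2\<close> are not represented explicitly;
  they appear below as an inequality between coefficients.
\<close>

definition gram_poly :: "'v set \<Rightarrow> nat \<Rightarrow> ('v monom \<Rightarrow> 'v mat) \<Rightarrow> 'v rpoly" where
  "gram_poly V r P = (\<Sum>\<beta>\<in>monoms V r. mono_poly \<beta> * quad_form V (P \<beta>))"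

lemma finite_monoms: "finite V \<Longrightarrow> finite (monoms V r)"
  by (rule finite_subset[OF _ finite_exponents[of V r]]) (auto simp: monoms_def exponents_def)

lemma exponents_eq_monoms: "exponents V r = monoms V r \<union> monoms V (r + 2)"
  by (auto simp: exponents_def monoms_def)

lemma sum_exponents:
  assumes "finite V"
  shows "sum f (exponents V r) = sum f (monoms V r) + sum f (monoms V (r + 2))"
  unfolding exponents_eq_monoms using finite_monoms[OF assms]
  by (intro sum.union_disjoint) (auto simp: monoms_def)

text \<open>
  Thus taking the constant term is a ring homomorphism.
\<close>

lemma coef_0_eq_poly_val: "coef p 0 = poly_val (\<lambda>_. 0) p"
proof -
  have "monom_val (\<lambda>_. 0) \<beta> = (if \<beta> = 0 then 1 else 0)" for \<beta> :: "'a monom"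
  proof (cases "\<beta> = 0")
    case False
    then obtain v where "v \<in> Poly_Mapping.keys \<beta>"
      using keys_eq_empty_nat by blast
    then show ?thesis using False
      unfolding monom_val_def by (auto intro!: prod_zero simp: in_keys_iff zero_power_eq)
  qed (simp add: monom_val_def)
  then have "poly_val (\<lambda>_. 0) p = (\<Sum>\<beta>\<in>Poly_Mapping.keys p. if \<beta> = 0 then coef p \<beta> else 0)"
    unfolding poly_val_def by (intro sum.cong) auto
  then show ?thesis by (auto simp: sum.delta in_keys_iff)
qed

lemma coef_0_power2: "coef (p ^ 2) 0 = (coef p 0)\<^sup>2"
  by (simp add: coef_0_eq_poly_val poly_val_power)

text \<open>
  For \<open>q = l + q'\<close> with \<open>l\<close> linear and \<open>q'\<close> without terms of degree below 2, all terms of \<open>q\<^sup>2 - l\<^sup>2\<close> have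
  degree at least 3.
\<close>

lemma coef_square_degree_2:
  assumes V: "finite V" "q \<in> poly_ring V" and q0: "coef q 0 = 0" and d: "mdeg \<delta> = 2"
  shows "coef (q ^ 2) \<delta> = coef (lin_form V (\<lambda>v. coef q (unit_monom v)) ^ 2) \<delta>"
proof -
  define l where "l = lin_form V (\<lambda>v. coef q (unit_monom v))"
  define q' where "q' = q - l"
  have l1: "min_deg 1 l"
    unfolding l_def by (intro homogeneous_min_deg homogeneous_lin_form)
  have "min_deg 2 q'"
    unfolding min_deg_def
  proof (intro ballI, rule ccontr)
    fix \<beta> assume b: "\<beta> \<in> Poly_Mapping.keys q'" "\<not> 2 \<le> mdeg \<beta>"
    then consider "mdeg \<beta> = 0" | "mdeg \<beta> = 1" by linarith
    then have "coef q' \<beta> = 0"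
    proof cases
      case 1
      then have "\<beta> = 0" by (simp add: mdeg_eq_0_iff)
      then show ?thesis using q0 coef_min_deg[OF l1, of 0] by (simp add: q'_def lookup_minus)
    next
      case 2
      then obtain v where v: "\<beta> = unit_monom v" by (rule mdeg_eq_1)
      have "coef q (unit_monom v) = 0" if "v \<notin> V"
      proof (rule ccontr)
        assume "coef q (unit_monom v) \<noteq> 0"
        then have "Poly_Mapping.keys (unit_monom v) \<subseteq> V"
          using V(2) unfolding poly_ring_def in_keys_iff[symmetric] by blast
        then show False using that by simp
      qed
      then show ?thesis
        using coef_lin_form[OF V(1), of "\<lambda>v. coef q (unit_monom v)" v]
        by (auto simp: q'_def v lookup_minus l_def split: if_splits)
    qed
    then show False using b by (simp add: in_keys_iff)
  qed
  then have "min_deg (1 + 2) (l * q')" "min_deg (2 + 2) (q' * q')"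
    using l1 by (intro min_deg_mult; simp)+
  then have "min_deg 3 (l * q')" "min_deg 3 (q' * q')"
    using min_deg_antimono[of "1 + 2" "l * q'" 3] min_deg_antimono[of "2 + 2" "q' * q'" 3]
    by simp_all
  then have "coef (l * q' + l * q' + q' * q') \<delta> = 0"
    using d by (intro coef_min_deg[of 3] min_deg_add) auto
  moreover have "q ^ 2 = l ^ 2 + (l * q' + l * q' + q' * q')"
    by (simp add: q'_def power2_eq_square algebra_simps)
  ultimately show ?thesis by (simp add: lookup_add l_def)
qed

lemma coef_mono_mult_same_degree:
  assumes "mdeg \<gamma> \<le> mdeg \<beta>"
  shows "coef (mono_poly \<beta> * p) \<gamma> = (if \<gamma> = \<beta> then coef p 0 else 0)"
proof (cases "\<gamma> = \<beta>")
  case True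
  then show ?thesis using coef_mono_mult[of \<beta> p 0] by simp
next
  case False
  then have "\<gamma> \<noteq> \<beta> + \<delta>" for \<delta>
    using assms by (auto simp: mdeg_eq_0_iff)
  then show ?thesis using False by (simp add: coef_mono_mult_0)
qed

lemma coef_sum_list: "coef (\<Sum>a\<leftarrow>as. p a) \<gamma> = (\<Sum>a\<leftarrow>as. coef (p a) \<gamma>)"
  by (induction as) (simp_all add: lookup_add)

lemma homogeneous_gram_poly: "homogeneous (r + 2) (gram_poly V r P)"
  unfolding gram_poly_def
proof (rule homogeneous_sum)
  fix \<beta> :: "'a monom" assume "\<beta> \<in> monoms V r"
  then show "homogeneous (r + 2) (mono_poly \<beta> * quad_form V (P \<beta>))"
    using homogeneous_mult[OF homogeneous_mono homogeneous_quad_form, of \<beta> V "P \<beta>"]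
    by (simp add: monoms_def)
qed

lemma gram_poly_in_ring: "gram_poly V r P \<in> poly_ring V"
  unfolding gram_poly_def
  by (intro poly_ring_sum poly_ring_mult poly_ring_mono quad_form_in_ring) (simp add: monoms_def)

lemma coef_gram_poly:
  "coef (gram_poly V r R) \<gamma> = (\<Sum>(\<beta>, i, j)\<in>monoms V r \<times> V \<times> V.
    R \<beta> i j * (if \<gamma> = \<beta> + unit_monom i + unit_monom j then 1 else 0))"
proof -
  have eq: "mono_poly \<beta> * (const_poly c * var i * var j) =
      const_poly c * mono_poly (\<beta> + unit_monom i + unit_monom j)" for \<beta> c i j
    unfolding mono_var_var[symmetric] by (simp add: mult_ac)
  have "coef (gram_poly V r R) \<gamma> = (\<Sum>\<beta>\<in>monoms V r. \<Sum>i\<in>V. \<Sum>j\<in>V.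
      R \<beta> i j * (if \<gamma> = \<beta> + unit_monom i + unit_monom j then 1 else 0))"
    unfolding gram_poly_def quad_form_def sum_distrib_left lookup_sum eq coef_const_mult coef_mono ..
  then show ?thesis by (simp add: sum.cartesian_product)
qed

text \<open>
  The constant term of \<open>\<sigma> \<beta>\<close>, for \<open>\<bar>\<beta>\<bar> = r\<close>, is the coefficient of \<open>x\<^sup>\<beta>\<close> in the homogeneous polynomial \<open>f\<close>
  of degree \<open>r + 2\<close>, hence zero. It is the sum of the squares of the constant terms of the \<open>q\<close>
  whose squares make up \<open>\<sigma> \<beta>\<close>, so these vanish too, and the Gram matrix of the linear parts of the \<open>q\<close>
  can be taken as \<open>P \<beta>\<close>: parts of \<open>q\<close> of degree 2 only contribute to degrees above \<open>r + 2\<close>.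
\<close>

lemma cone_H_imp_gram:
  assumes V: "finite V" and f: "f \<in> cone_H V r"
  shows "\<exists>P. (\<forall>\<beta>\<in>monoms V r. psd V (P \<beta>)) \<and> (\<forall>\<gamma>. coef (gram_poly V r P) \<gamma> \<le> coef f \<gamma>)"
proof -
  from f obtain \<sigma> where hom: "homogeneous (r + 2) f"
    and sos: "\<And>\<beta>. \<beta> \<in> exponents V r \<Longrightarrow> \<sigma> \<beta> \<in> sos V (r + 2 - mdeg \<beta>)"
    and f_eq: "f = (\<Sum>\<beta>\<in>exponents V r. mono_poly \<beta> * \<sigma> \<beta>)"
    by (auto simp: cone_H_def)
  have "\<exists>qs. \<sigma> \<beta> = (\<Sum>q\<leftarrow>qs. q ^ 2) \<and> set qs \<subseteq> poly_ring V" if "\<beta> \<in> exponents V r" for \<beta>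
    using sos[OF that] by (auto simp: sos_def)
  then obtain qs where qs: "\<And>\<beta>. \<beta> \<in> exponents V r \<Longrightarrow> \<sigma> \<beta> = (\<Sum>q\<leftarrow>qs \<beta>. q ^ 2)"
    "\<And>\<beta>. \<beta> \<in> exponents V r \<Longrightarrow> set (qs \<beta>) \<subseteq> poly_ring V"
    by metis
  have \<sigma>0: "coef (\<sigma> \<beta>) 0 = (\<Sum>q\<leftarrow>qs \<beta>. (coef q 0)\<^sup>2)" if "\<beta> \<in> exponents V r" for \<beta>
    using qs(1)[OF that] by (simp add: coef_sum_list coef_0_power2)
  have q0: "coef q 0 = 0" if b: "\<beta> \<in> monoms V r" and q: "q \<in> set (qs \<beta>)" for \<beta> q
  proof -
    have e: "\<beta> \<in> exponents V r" using b by (simp add: exponents_eq_monoms)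
    have "0 = coef f \<beta>"
      using b by (intro coef_homogeneous[OF hom, symmetric]) (auto simp: monoms_def)
    also have "\<dots> = (\<Sum>\<beta>'\<in>exponents V r. if \<beta> = \<beta>' then coef (\<sigma> \<beta>') 0 else 0)"
      unfolding f_eq lookup_sum using b
      by (intro sum.cong coef_mono_mult_same_degree) (auto simp: monoms_def exponents_def)
    also have "\<dots> = (\<Sum>q\<leftarrow>qs \<beta>. (coef q 0)\<^sup>2)"
      using e finite_exponents[OF V] \<sigma>0 by (simp add: sum.delta')
    finally have "(\<Sum>q\<leftarrow>qs \<beta>. (coef q 0)\<^sup>2) = 0" by simp
    then have "\<forall>y\<in>set (map (\<lambda>q. (coef q 0)\<^sup>2) (qs \<beta>)). y = 0"
      by (subst (asm) sum_list_nonneg_eq_0_iff) auto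
    then show ?thesis using q by simp
  qed
  define ls where "ls \<beta> = map (\<lambda>q v. coef q (unit_monom v)) (qs \<beta>)" for \<beta>
  define P where "P \<beta> i j = (\<Sum>l\<leftarrow>ls \<beta>. l i * l j)" for \<beta> i j
  have "coef (gram_poly V r P) \<gamma> \<le> coef f \<gamma>" for \<gamma>
  proof (cases "mdeg \<gamma> = r + 2")
    case False
    then show ?thesis
      using coef_homogeneous[OF hom] coef_homogeneous[OF homogeneous_gram_poly] by fastforce
  next
    case True
    have "coef (mono_poly \<beta> * \<sigma> \<beta>) \<gamma> = coef (mono_poly \<beta> * quad_form V (P \<beta>)) \<gamma>"
      if b: "\<beta> \<in> monoms V r" for \<beta>
    proof (cases "\<exists>\<delta>. \<gamma> = \<beta> + \<delta>")
      case False
      then show ?thesis by (simp add: coef_mono_mult_0)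
    next
      case ex: True
      then obtain \<delta> where \<delta>: "\<gamma> = \<beta> + \<delta>" by blast
      then have d: "mdeg \<delta> = 2" using True b by (simp add: monoms_def)
      have e: "\<beta> \<in> exponents V r" using b by (simp add: exponents_eq_monoms)
      have "coef (\<sigma> \<beta>) \<delta> = (\<Sum>q\<leftarrow>qs \<beta>. coef (q ^ 2) \<delta>)"
        using qs(1)[OF e] by (simp add: coef_sum_list)
      also have "\<dots> = (\<Sum>q\<leftarrow>qs \<beta>. coef (lin_form V (\<lambda>v. coef q (unit_monom v)) ^ 2) \<delta>)"
        using qs(2)[OF e] q0[OF b] by (intro arg_cong[where f=sum_list] map_cong refl coef_square_degree_2[OF V _ _ d]) auto
      also have "\<dots> = coef (quad_form V (P \<beta>)) \<delta>"
        unfolding P_def quad_form_sum_list by (simp add: coef_sum_list ls_def o_def)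
      finally show ?thesis by (simp add: \<delta> coef_mono_mult)
    qed
    then have "coef (gram_poly V r P) \<gamma> = (\<Sum>\<beta>\<in>monoms V r. coef (mono_poly \<beta> * \<sigma> \<beta>) \<gamma>)"
      by (simp add: gram_poly_def lookup_sum)
    moreover have "0 \<le> (\<Sum>\<beta>\<in>monoms V (r + 2). coef (mono_poly \<beta> * \<sigma> \<beta>) \<gamma>)"
    proof (rule sum_nonneg)
      fix \<beta> assume b: "\<beta> \<in> monoms V (r + 2)"
      then have "coef (\<sigma> \<beta>) 0 \<ge> 0"
        using \<sigma>0 by (auto simp: exponents_eq_monoms intro!: sum_list_nonneg)
      then show "0 \<le> coef (mono_poly \<beta> * \<sigma> \<beta>) \<gamma>"
        using True b by (subst coef_mono_mult_same_degree) (auto simp: monoms_def)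
    qed
    ultimately show ?thesis
      by (simp add: f_eq lookup_sum lookup_add sum_exponents[OF V])
  qed
  moreover have "psd V (P \<beta>)" for \<beta>
    using psd_sum_list[of V "ls \<beta>"] by (simp add: P_def[abs_def])
  ultimately show ?thesis by (intro exI[of _ P]) simp
qed

text \<open>
  The remainder \<open>f - gram_poly V r P\<close> has nonnegative coefficients; each is the square of its square root,
  which is a valid \<open>\<sigma> \<beta>\<close> for \<open>\<bar>\<beta>\<bar> = r + 2\<close>.
\<close>

lemma gram_imp_cone_H:
  assumes V: "finite V" and f: "f \<in> poly_ring V" "homogeneous (r + 2) f"
    and psd: "\<And>\<beta>. \<beta> \<in> monoms V r \<Longrightarrow> psd V (P \<beta>)"
    and le: "\<And>\<gamma>. coef (gram_poly V r P) \<gamma> \<le> coef f \<gamma>"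
  shows "f \<in> cone_H V r"
proof -
  have "\<exists>ls. \<forall>i\<in>V. \<forall>j\<in>V. P \<beta> i j = (\<Sum>l\<leftarrow>ls. l i * l j)" if "\<beta> \<in> monoms V r" for \<beta>
    using psd_imp_sum_of_squares[OF V psd[OF that]] .
  then obtain ls where
    ls: "\<And>\<beta> i j. \<beta> \<in> monoms V r \<Longrightarrow> i \<in> V \<Longrightarrow> j \<in> V \<Longrightarrow> P \<beta> i j = (\<Sum>l\<leftarrow>ls \<beta>. l i * l j)"
    by metis
  define g where "g = f - gram_poly V r P"
  have g: "coef g \<gamma> \<ge> 0" for \<gamma> using le by (simp add: g_def lookup_minus)
  define \<sigma> where "\<sigma> \<beta> = (if mdeg \<beta> = r then (\<Sum>q\<leftarrow>map (lin_form V) (ls \<beta>). q ^ 2)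
    else (\<Sum>q\<leftarrow>[const_poly (sqrt (coef g \<beta>))]. q ^ 2))" for \<beta>
  have "\<sigma> \<beta> \<in> sos V (r + 2 - mdeg \<beta>)" if "\<beta> \<in> exponents V r" for \<beta>
  proof (cases "mdeg \<beta> = r")
    case True
    have "deg_le 2 (lin_form V l)" for l
      using homogeneous_lin_form[of V l] by (auto simp: deg_le_def homogeneous_def)
    then show ?thesis
      using True lin_form_in_ring[of V] unfolding \<sigma>_def sos_def if_P[OF True]
      by (intro CollectI exI[of _ "map (lin_form V) (ls \<beta>)"]) auto
  next
    case False
    have "deg_le 0 (const_poly c)" for c
      using homogeneous_const[of c] by (auto simp: deg_le_def homogeneous_def)
    moreover have "mdeg \<beta> = r + 2" using False that by (auto simp: exponents_def)
    ultimately show ?thesis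
      using poly_ring_const unfolding \<sigma>_def sos_def if_not_P[OF False]
      by (intro CollectI exI[of _ "[const_poly (sqrt (coef g \<beta>))]"]) auto
  qed
  moreover have "f = (\<Sum>\<beta>\<in>exponents V r. mono_poly \<beta> * \<sigma> \<beta>)"
  proof -
    have "(\<Sum>\<beta>\<in>monoms V r. mono_poly \<beta> * \<sigma> \<beta>) = gram_poly V r P"
      unfolding gram_poly_def
    proof (intro sum.cong refl arg_cong2[where f="(*)"])
      fix \<beta> assume b: "\<beta> \<in> monoms V r"
      have "quad_form V (P \<beta>) = quad_form V (\<lambda>i j. \<Sum>l\<leftarrow>ls \<beta>. l i * l j)"
        by (rule quad_form_cong) (rule ls[OF b])
      also have "\<dots> = \<sigma> \<beta>"
        using b by (simp add: quad_form_sum_list \<sigma>_def monoms_def o_def)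
      finally show "\<sigma> \<beta> = quad_form V (P \<beta>)" by simp
    qed
    moreover have "(\<Sum>\<beta>\<in>monoms V (r + 2). mono_poly \<beta> * \<sigma> \<beta>) = g"
    proof -
      have "Poly_Mapping.keys g \<subseteq> monoms V (r + 2)"
        using f gram_poly_in_ring[of V r P] homogeneous_gram_poly[of r V P]
          keys_diff[of f "gram_poly V r P"]
        unfolding g_def monoms_def poly_ring_def homogeneous_def by blast
      moreover have "mono_poly \<beta> * \<sigma> \<beta> = Poly_Mapping.single \<beta> (coef g \<beta>)" if "\<beta> \<in> monoms V (r + 2)" for \<beta>
        using that g[of \<beta>]
        by (simp add: \<sigma>_def monoms_def mono_poly_def const_poly_def power2_eq_square mult_single)
      ultimately have "(\<Sum>\<beta>\<in>monoms V (r + 2). mono_poly \<beta> * \<sigma> \<beta>) =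
          (\<Sum>\<beta>\<in>Poly_Mapping.keys g. Poly_Mapping.single \<beta> (coef g \<beta>))"
        using finite_monoms[OF V]
        by (intro sum.mono_neutral_cong_right) (auto simp: in_keys_iff)
      then show ?thesis by (simp flip: poly_expand)
    qed
    ultimately show ?thesis by (simp add: sum_exponents[OF V] g_def)
  qed
  ultimately show ?thesis using f unfolding cone_H_def by blast
qed

lemma poly_val_gram:
  "poly_val x (gram_poly V r P) = (\<Sum>\<beta>\<in>monoms V r. monom_val x \<beta> * quad_val V (P \<beta>) x)"
  by (simp add: gram_poly_def poly_val_sum poly_val_mult poly_val_quad_form)

lemma cone_H_poly_val_nonneg:
  assumes "finite V" "f \<in> cone_H V r" "\<And>v. x v \<ge> 0"
  shows "poly_val x f \<ge> 0"
proof -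
  obtain P where P: "\<And>\<beta>. \<beta> \<in> monoms V r \<Longrightarrow> psd V (P \<beta>)"
    "\<And>\<gamma>. coef (gram_poly V r P) \<gamma> \<le> coef f \<gamma>"
    using cone_H_imp_gram[OF assms(1,2)] by blast
  have "0 \<le> poly_val x (gram_poly V r P)"
    unfolding poly_val_gram using P(1) assms(3)
    by (intro sum_nonneg mult_nonneg_nonneg monom_val_nonneg) (auto simp: psd_def)
  also have "\<dots> \<le> poly_val x f"
    using assms(3) P(2) by (rule poly_val_mono_coefs)
  finally show ?thesis .
qed

lemma mult_quad_form_eq_gram:
  assumes "finite V" "p \<in> poly_ring V" "homogeneous r p"
  shows "p * quad_form V M = gram_poly V r (\<lambda>\<beta> i j. coef p \<beta> * M i j)"
proof -
  have keys: "Poly_Mapping.keys p \<subseteq> monoms V r"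
    using assms by (auto simp: poly_ring_def homogeneous_def monoms_def)
  have "p = (\<Sum>\<beta>\<in>Poly_Mapping.keys p. Poly_Mapping.single \<beta> (coef p \<beta>))"
    by (rule poly_expand)
  also have "\<dots> = (\<Sum>\<beta>\<in>monoms V r. mono_poly \<beta> * const_poly (coef p \<beta>))"
    using keys finite_monoms[OF assms(1)]
    by (intro sum.mono_neutral_cong_left)
      (auto simp: mono_poly_def const_poly_def mult_single in_keys_iff)
  finally have "p * quad_form V M =
      (\<Sum>\<beta>\<in>monoms V r. mono_poly \<beta> * const_poly (coef p \<beta>)) * quad_form V M"
    by (rule arg_cong[where f="\<lambda>p. p * _"])
  then show ?thesis
    by (simp add: gram_poly_def quad_form_scale sum_distrib_right mult.assoc)
qed

text \<open>
  If \<open>M\<close> is the sum of a positive semidefinite and a nonnegative matrix, every multiplier with nonnegative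
  coefficients works.
\<close>

lemma mult_quad_form_in_cone_H:
  assumes V: "finite V" and p: "p \<in> cone_N V r" and S: "psd V S"
    and SM: "\<And>i j. i \<in> V \<Longrightarrow> j \<in> V \<Longrightarrow> S i j \<le> M i j"
  shows "p * quad_form V M \<in> cone_H V r"
proof (rule gram_imp_cone_H[OF V])
  have p': "p \<in> poly_ring V" "homogeneous r p" "\<And>\<beta>. coef p \<beta> \<ge> 0"
    using p by (auto simp: cone_N_def)
  show "p * quad_form V M \<in> poly_ring V"
    by (intro poly_ring_mult p' quad_form_in_ring)
  show "homogeneous (r + 2) (p * quad_form V M)"
    by (intro homogeneous_mult p' homogeneous_quad_form)
  show "psd V (\<lambda>i j. coef p \<beta> * S i j)" for \<beta>
    by (intro psd_scale p' S)
  have "nonneg_coefs (p * quad_form V (\<lambda>i j. M i j - S i j))"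
    using p' SM by (intro nonneg_coefs_mult nonneg_coefs_quad_form) (auto simp: nonneg_coefs_def)
  moreover have "p * quad_form V M = gram_poly V r (\<lambda>\<beta> i j. coef p \<beta> * S i j)
      + p * quad_form V (\<lambda>i j. M i j - S i j)"
    using mult_quad_form_eq_gram[OF V p'(1,2), of S] quad_form_add[of V S "\<lambda>i j. M i j - S i j"]
    by (simp add: distrib_left)
  ultimately show "coef (gram_poly V r (\<lambda>\<beta> i j. coef p \<beta> * S i j)) \<gamma> \<le> coef (p * quad_form V M) \<gamma>" for \<gamma>
    by (simp add: lookup_add nonneg_coefs_def)
qed

text \<open>
  At a nonnegative zero of \<open>f\<close>, all nonnegative summands \<open>x\<^sup>\<beta> x\<^sup>T P\<^sub>\<beta> x\<close> of a lower bound for \<open>f\<close> vanish.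
\<close>

lemma gram_kernel:
  assumes V: "finite V" and P: "\<And>\<beta>. \<beta> \<in> monoms V r \<Longrightarrow> psd V (P \<beta>)"
    and le: "\<And>\<gamma>. coef (gram_poly V r P) \<gamma> \<le> coef f \<gamma>"
    and x: "\<And>v. x v \<ge> 0" "poly_val x f = 0"
    and b: "\<beta> \<in> monoms V r" "monom_val x \<beta> > 0"
  shows "bilin V (P \<beta>) x y = 0"
proof (rule psd_kernel[OF P[OF b(1)]])
  have nn: "0 \<le> monom_val x \<beta> * quad_val V (P \<beta>) x" if "\<beta> \<in> monoms V r" for \<beta>
    using P[OF that] x(1) by (intro mult_nonneg_nonneg monom_val_nonneg) (auto simp: psd_def)
  have "monom_val x \<beta> * quad_val V (P \<beta>) x \<le> poly_val x (gram_poly V r P)"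
    unfolding poly_val_gram using nn finite_monoms[OF V] b(1) by (intro member_le_sum) auto
  also have "\<dots> \<le> 0"
    using poly_val_mono_coefs[of x, OF x(1) le] x(2) by simp
  finally have "monom_val x \<beta> * quad_val V (P \<beta>) x = 0"
    using nn[OF b(1)] by simp
  then show "quad_val V (P \<beta>) x = 0" using b(2) by simp
qed

lemma monoms_1: "monoms V 1 = unit_monom ` V"
proof -
  have "\<beta> \<in> unit_monom ` V" if "\<beta> \<in> monoms V 1" for \<beta>
  proof -
    have "mdeg \<beta> = 1" using that by (simp add: monoms_def)
    then obtain v where "\<beta> = unit_monom v" by (rule mdeg_eq_1)
    then show ?thesis using that by (auto simp: monoms_def)
  qed
  then show ?thesis by (auto simp: monoms_def)
qed

text \<open>
  Gram representations of order 1: the monomials of degree 1 are the variables, so the matrices can be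
  indexed by vertices.
\<close>

lemma linear_multiplier_in_cone_H:
  assumes V: "finite V" and f: "f \<in> poly_ring V" "homogeneous 3 f"
    and R: "\<And>v. v \<in> V \<Longrightarrow> psd V (R v)"
    and nn: "nonneg_coefs (f - (\<Sum>v\<in>V. var v * quad_form V (R v)))"
  shows "f \<in> cone_H V 1"
proof -
  define P where "P \<beta> = R (THE v. \<beta> = unit_monom v)" for \<beta>
  have P: "P (unit_monom v) = R v" for v
    unfolding P_def by (rule arg_cong[where f=R], rule the_equality) auto
  have "gram_poly V 1 P = (\<Sum>v\<in>V. mono_poly (unit_monom v) * quad_form V (P (unit_monom v)))"
    unfolding gram_poly_def monoms_1 by (subst sum.reindex) (auto simp: inj_on_def)
  also have "\<dots> = (\<Sum>v\<in>V. var v * quad_form V (R v))"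
    unfolding P var_eq_mono ..
  finally have gram: "gram_poly V 1 P = (\<Sum>v\<in>V. var v * quad_form V (R v))" .
  show ?thesis
  proof (rule gram_imp_cone_H[OF V f(1)])
    show "homogeneous (1 + 2) f" using f(2) by (simp add: numeral_3_eq_3)
    show "psd V (P \<beta>)" if "\<beta> \<in> monoms V 1" for \<beta>
      using that R P unfolding monoms_1 by auto
    show "coef (gram_poly V 1 P) \<gamma> \<le> coef f \<gamma>" for \<gamma>
      using nn unfolding gram by (simp add: nonneg_coefs_def lookup_minus)
  qed
qed

section \<open>Closedness of the cone\<close>

lemma common_convergent_subseq:
  fixes a :: "nat \<Rightarrow> 'i \<Rightarrow> real"
  assumes "finite I" "\<And>i. i \<in> I \<Longrightarrow> Bseq (\<lambda>n. a n i)"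
  shows "\<exists>\<phi> :: nat \<Rightarrow> nat. strict_mono \<phi> \<and> (\<forall>i\<in>I. convergent (\<lambda>n. a (\<phi> n) i))"
  using assms
proof (induction I rule: finite_induct)
  case empty
  show ?case by (intro exI[of _ "\<lambda>n. n"]) (simp add: strict_mono_def)
next
  case (insert j I)
  then obtain \<phi> where \<phi>: "strict_mono \<phi>" "\<And>i. i \<in> I \<Longrightarrow> convergent (\<lambda>n. a (\<phi> n) i)"
    by auto
  obtain \<psi> where \<psi>: "strict_mono \<psi>" "monoseq (\<lambda>n. a (\<phi> (\<psi> n)) j)"
    using seq_monosub[of "\<lambda>n. a (\<phi> n) j"] by auto
  have "Bseq (\<lambda>n. a (\<phi> (\<psi> n)) j)"
    using Bseq_subseq[of "\<lambda>n. a n j" "\<phi> \<circ> \<psi>"] insert.prems by simp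
  then have "convergent (\<lambda>n. a (\<phi> (\<psi> n)) j)"
    using \<psi>(2) by (rule Bseq_monoseq_convergent)
  moreover have "convergent (\<lambda>n. a (\<phi> (\<psi> n)) i)" if "i \<in> I" for i
    using convergent_subseq_convergent[OF \<phi>(2)[OF that] \<psi>(1)] by (simp add: o_def)
  ultimately show ?case
    using strict_mono_o[OF \<phi>(1) \<psi>(1)] by (intro exI[of _ "\<lambda>n. \<phi> (\<psi> n)"]) (auto simp: o_def)
qed

text \<open>
  At points with all coordinates at least 1 every monomial is at least 1, hence each \<open>x\<^sup>T P\<^sub>\<beta> x\<close> is bounded by
  the value of \<open>f\<close>. The bound on the diagonal entry follows from the two points \<open>1\<close> and \<open>1 + e\<^sub>i\<close>, since
  \<open>0 \<le> P(e\<^sub>i + 2) = 2 P(e\<^sub>i + 1) + 2 P(1) - P(e\<^sub>i)\<close>, where \<open>1\<close> and \<open>2\<close> are constant vectors.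
\<close>

lemma gram_diag_bound:
  assumes V: "finite V" and P: "\<And>\<beta>. \<beta> \<in> monoms V r \<Longrightarrow> psd V (P \<beta>)"
    and le: "\<And>\<gamma>. coef (gram_poly V r P) \<gamma> \<le> coef f \<gamma>"
    and b: "\<beta> \<in> monoms V r" and i: "i \<in> V"
  shows "P \<beta> i i \<le> 2 * (poly_val (\<lambda>_. 1) f + poly_val (\<lambda>v. 1 + indicator {i} v) f)"
proof -
  have val: "quad_val V (P \<beta>) x \<le> poly_val x f" if x: "\<And>v. x v \<ge> 1" for x
  proof -
    have x0: "x v \<ge> 0" for v using x[of v] by simp
    have nn: "0 \<le> quad_val V (P \<beta>) x" if "\<beta> \<in> monoms V r" for \<beta>
      using P[OF that] by (simp add: psd_def)
    have "1 \<le> monom_val x \<beta>"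
      unfolding monom_val_def using x by (intro prod_ge_1 one_le_power) auto
    then have "quad_val V (P \<beta>) x \<le> monom_val x \<beta> * quad_val V (P \<beta>) x"
      using nn[OF b] by (simp add: mult_le_cancel_right1)
    also have "\<dots> \<le> poly_val x (gram_poly V r P)"
      unfolding poly_val_gram
      using nn x0 finite_monoms[OF V] b
      by (intro member_le_sum mult_nonneg_nonneg monom_val_nonneg) auto
    also have "\<dots> \<le> poly_val x f" by (rule poly_val_mono_coefs[OF x0 le])
    finally show ?thesis .
  qed
  have s: "sym_mat V (P \<beta>)" using P[OF b] by (simp add: psd_def)
  let ?e = "indicator {i} :: 'a \<Rightarrow> real"
  have "0 \<le> quad_val V (P \<beta>) (\<lambda>v. ?e v + 2 * 1)"
    using P[OF b] by (simp add: psd_def)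
  moreover have "quad_val V (P \<beta>) (\<lambda>v. ?e v + 1 * 1) \<le> poly_val (\<lambda>v. 1 + ?e v) f"
    using val[of "\<lambda>v. 1 + ?e v"] by (simp add: add.commute)
  moreover have "quad_val V (P \<beta>) (\<lambda>v. 1) \<le> poly_val (\<lambda>_. 1) f"
    by (rule val) simp
  ultimately show ?thesis
    unfolding quad_val_line[OF s] using quad_val_unit[OF V i, of "P \<beta>"] by simp
qed

text \<open>
  By the bound on diagonal entries the Gram matrices of the members of the sequence range over a bounded subset of a
  finite-dimensional space. The limit of a convergent subsequence represents \<open>g\<close>.
\<close>

lemma cone_H_closed:
  assumes V: "finite V" and f: "\<And>n. f n \<in> cone_H V r"
    and g: "g \<in> poly_ring V" "homogeneous (r + 2) g"
    and lim: "\<And>\<gamma>. (\<lambda>n. coef (f n) \<gamma>) \<longlonglongrightarrow> coef g \<gamma>"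
  shows "g \<in> cone_H V r"
proof -
  have "\<exists>P. (\<forall>\<beta>\<in>monoms V r. psd V (P \<beta>)) \<and> (\<forall>\<gamma>. coef (gram_poly V r P) \<gamma> \<le> coef (f n) \<gamma>)" for n
    by (rule cone_H_imp_gram[OF V f])
  then obtain P where P: "\<And>n \<beta>. \<beta> \<in> monoms V r \<Longrightarrow> psd V (P n \<beta>)"
    "\<And>n \<gamma>. coef (gram_poly V r (P n)) \<gamma> \<le> coef (f n) \<gamma>"
    by metis
  have val: "Bseq (\<lambda>n. poly_val x (f n))" for x
  proof -
    have "Poly_Mapping.keys (f n) \<subseteq> monoms V (r + 2)" for n
      using f[of n] by (auto simp: cone_H_def poly_ring_def homogeneous_def monoms_def)
    then have "poly_val x (f n) = (\<Sum>\<beta>\<in>monoms V (r + 2). coef (f n) \<beta> * monom_val x \<beta>)" for n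
      by (rule poly_val_superset[OF finite_monoms[OF V]])
    moreover have lim': "(\<lambda>n. \<Sum>\<beta>\<in>monoms V (r + 2). coef (f n) \<beta> * monom_val x \<beta>)
        \<longlonglongrightarrow> (\<Sum>\<beta>\<in>monoms V (r + 2). coef g \<beta> * monom_val x \<beta>)"
      using lim by (intro tendsto_sum tendsto_mult tendsto_const)
    ultimately show ?thesis using convergent_imp_Bseq[OF convergentI[OF lim']] by simp
  qed
  have diag: "Bseq (\<lambda>n. P n \<beta> i i)" if "\<beta> \<in> monoms V r" "i \<in> V" for \<beta> i
  proof -
    have bound: "\<exists>A. \<forall>n. \<bar>poly_val x (f n)\<bar> \<le> A" for x
      using val[of x] by (auto simp: Bseq_def)
    obtain A where A: "\<And>n. \<bar>poly_val (\<lambda>_. 1) (f n)\<bar> \<le> A"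
      using bound[of "\<lambda>_. 1"] by blast
    obtain B where B: "\<And>n. \<bar>poly_val (\<lambda>v. 1 + indicator {i} v) (f n)\<bar> \<le> B"
      using bound[of "\<lambda>v. 1 + indicator {i} v"] by blast
    have le: "P n \<beta> i i \<le> 2 * (poly_val (\<lambda>_. 1) (f n) + poly_val (\<lambda>v. 1 + indicator {i} v) (f n))" for n
      by (rule gram_diag_bound[OF V P(1) P(2) that])
    have "\<bar>P n \<beta> i i\<bar> \<le> 2 * (A + B)" for n
    proof -
      have "0 \<le> P n \<beta> i i" by (rule psd_diag_nonneg[OF V P(1)[OF that(1)] that(2)])
      then have "\<bar>P n \<beta> i i\<bar> = P n \<beta> i i" by simp
      also note le[of n]
      also have "2 * (poly_val (\<lambda>_. 1) (f n) + poly_val (\<lambda>v. 1 + indicator {i} v) (f n)) \<le> 2 * (A + B)"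
        using abs_le_D1[OF A[of n]] abs_le_D1[OF B[of n]] by (intro mult_left_mono add_mono) auto
      finally show ?thesis .
    qed
    then show ?thesis by (intro BseqI') auto
  qed
  define I where "I = monoms V r \<times> V \<times> V"
  have "Bseq (\<lambda>n. case k of (\<beta>, i, j) \<Rightarrow> P n \<beta> i j)" if k: "k \<in> I" for k
  proof -
    obtain \<beta> i j where k': "k = (\<beta>, i, j)" "\<beta> \<in> monoms V r" "i \<in> V" "j \<in> V"
      using k by (auto simp: I_def)
    obtain A B where AB: "\<And>n. \<bar>P n \<beta> i i\<bar> \<le> A" "\<And>n. \<bar>P n \<beta> j j\<bar> \<le> B"
      using diag[OF k'(2,3)] diag[OF k'(2,4)] unfolding Bseq_def real_norm_def by blast
    have "\<bar>P n \<beta> i j\<bar> \<le> A + B" for n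
      using psd_entry_bound[OF V P(1)[OF k'(2)] k'(3,4), of n] AB[of n] by linarith
    then show ?thesis unfolding k'(1) by (intro BseqI') auto
  qed
  moreover have "finite I" using finite_monoms[OF V] V by (simp add: I_def)
  ultimately obtain \<phi> where \<phi>: "strict_mono \<phi>"
    "\<And>k. k \<in> I \<Longrightarrow> convergent (\<lambda>n. case k of (\<beta>, i, j) \<Rightarrow> P (\<phi> n) \<beta> i j)"
    using common_convergent_subseq[of I "\<lambda>n k. case k of (\<beta>, i, j) \<Rightarrow> P n \<beta> i j"] by blast
  define Q where "Q \<beta> i j = lim (\<lambda>n. P (\<phi> n) \<beta> i j)" for \<beta> i j
  have Q: "(\<lambda>n. P (\<phi> n) \<beta> i j) \<longlonglongrightarrow> Q \<beta> i j" if "\<beta> \<in> monoms V r" "i \<in> V" "j \<in> V" for \<beta> i j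
    using \<phi>(2)[of "(\<beta>, i, j)"] that by (simp add: I_def Q_def convergent_LIMSEQ_iff)
  show ?thesis
  proof (rule gram_imp_cone_H[OF V g])
    fix \<beta> assume b: "\<beta> \<in> monoms V r"
    have "sym_mat V (Q \<beta>)"
      using P(1)[OF b] by (simp add: Q_def psd_def sym_mat_def)
    moreover have "0 \<le> quad_val V (Q \<beta>) x" for x
    proof (rule LIMSEQ_le_const)
      show "(\<lambda>n. quad_val V (P (\<phi> n) \<beta>) x) \<longlonglongrightarrow> quad_val V (Q \<beta>) x"
        unfolding quad_val_def using Q[OF b] by (intro tendsto_sum tendsto_mult tendsto_const)
      show "\<exists>N. \<forall>n\<ge>N. 0 \<le> quad_val V (P (\<phi> n) \<beta>) x"
        using P(1)[OF b] by (simp add: psd_def)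
    qed
    ultimately show "psd V (Q \<beta>)" by (simp add: psd_def)
  next
    fix \<gamma>
    show "coef (gram_poly V r Q) \<gamma> \<le> coef g \<gamma>"
    proof (rule LIMSEQ_le)
      show "(\<lambda>n. coef (gram_poly V r (P (\<phi> n))) \<gamma>) \<longlonglongrightarrow> coef (gram_poly V r Q) \<gamma>"
        unfolding coef_gram_poly split_def using Q by (intro tendsto_sum tendsto_mult tendsto_const) auto
      show "(\<lambda>n. coef (f (\<phi> n)) \<gamma>) \<longlonglongrightarrow> coef g \<gamma>"
        using LIMSEQ_subseq_LIMSEQ[OF lim \<phi>(1)] by (simp add: o_def)
      show "\<exists>N. \<forall>n\<ge>N. coef (gram_poly V r (P (\<phi> n))) \<gamma> \<le> coef (f (\<phi> n)) \<gamma>"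
        using P(2) by blast
    qed
  qed
qed

section \<open>Copositivity\<close>

text \<open>
  The multiplier may vanish at \<open>x\<close>, but it is positive where all coordinates are positive; so \<open>x\<close> is
  approached along \<open>x + e\<close> with \<open>e > 0\<close>.
\<close>

lemma multiplier_imp_copositive:
  assumes V: "finite V" and p: "p \<in> cone_N V r" "p \<noteq> 0" and M: "sym_mat V M"
    and H: "p * quad_form V M \<in> cone_H V r" and x: "\<And>v. x v \<ge> 0"
  shows "quad_val V M x \<ge> 0"
proof -
  let ?q = "\<lambda>e. quad_val V M x + 2 * e * bilin V M x (\<lambda>_. 1) + e\<^sup>2 * quad_val V M (\<lambda>_. 1)"
  have pos: "?q e \<ge> 0" if e: "e > 0" for e :: real
  proof -
    define y where "y v = x v + e * 1" for v
    have y: "y v > 0" for v using x[of v] e by (simp add: y_def)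
    obtain \<beta> where b: "coef p \<beta> \<noteq> 0"
      using p(2) poly_mapping_eqI[of p 0] by fastforce
    have mv: "monom_val y \<gamma> > 0" for \<gamma>
      unfolding monom_val_def using y by (intro prod_pos) auto
    have nn: "coef p \<gamma> \<ge> 0" for \<gamma> using p(1) by (simp add: cone_N_def)
    have "poly_val y p > 0"
      unfolding poly_val_def
    proof (rule sum_pos2[of _ \<beta>])
      show "0 < coef p \<beta> * monom_val y \<beta>"
        using b nn[of \<beta>] mv[of \<beta>] by simp
    qed (use b nn mv in \<open>auto simp: in_keys_iff less_imp_le\<close>)
    moreover have "0 \<le> poly_val y p * quad_val V M y"
      using cone_H_poly_val_nonneg[OF V H, of y] y
      by (simp add: poly_val_mult poly_val_quad_form less_imp_le)
    ultimately have "quad_val V M y \<ge> 0" by (simp add: zero_le_mult_iff)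
    then show ?thesis using quad_val_line[OF M, of x e "\<lambda>_. 1"] by (simp add: y_def[abs_def])
  qed
  have "(?q \<longlongrightarrow> quad_val V M x + 2 * 0 * bilin V M x (\<lambda>_. 1) + 0\<^sup>2 * quad_val V M (\<lambda>_. 1)) (at_right 0)"
    by (intro tendsto_intros)
  moreover have "eventually (\<lambda>e. ?q e \<ge> 0) (at_right 0)"
    using pos eventually_at_right_less[of "0::real"] by (auto elim: eventually_mono)
  ultimately show ?thesis
    using tendsto_lowerbound[of ?q _ "at_right 0" 0] by simp
qed

subsection \<open>Powers of the sum of the variables\<close>

lemma sum_vars_power_in_cone_N: "(\<Sum>v\<in>V. var v) ^ r \<in> cone_N V r"
proof -
  have "nonneg_coefs ((\<Sum>v\<in>V. var v) ^ r)"
    by (intro nonneg_coefs_power nonneg_coefs_sum nonneg_coefs_var)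
  then show ?thesis
    unfolding cone_N_def nonneg_coefs_def
    by (auto intro!: poly_ring_intros homogeneous_power homogeneous_sum homogeneous_var
        simp del: One_nat_def)
qed

lemma coef_sum_vars_power_pos:
  assumes "finite V" "\<beta> \<in> monoms V r"
  shows "coef ((\<Sum>v\<in>V. var v) ^ r) \<beta> > 0"
  using assms(2)
proof (induction r arbitrary: \<beta>)
  case 0
  then show ?case by (simp add: monoms_def mdeg_eq_0_iff lookup_one)
next
  case (Suc r)
  let ?s = "\<Sum>v\<in>V. var v"
  have "\<beta> \<noteq> 0" using Suc.prems by (auto simp: monoms_def)
  then obtain v where v: "v \<in> Poly_Mapping.keys \<beta>"
    using keys_eq_empty_nat by blast
  then obtain \<delta> where \<delta>: "\<beta> = \<delta> + unit_monom v" by (rule monom_split_unit)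
  have vV: "v \<in> V" using v Suc.prems by (auto simp: monoms_def)
  have "\<delta> \<in> monoms V r"
    using Suc.prems by (auto simp: monoms_def \<delta> keys_add_nat)
  then have "0 < coef (?s ^ r) \<delta>" by (rule Suc.IH)
  also have "\<dots> = coef (mono_poly (unit_monom v) * ?s ^ r) \<beta>"
    using coef_mono_mult[of "unit_monom v" "?s ^ r" \<delta>] by (simp add: \<delta> add.commute)
  also have "\<dots> \<le> (\<Sum>i\<in>V. coef (mono_poly (unit_monom i) * ?s ^ r) \<beta>)"
  proof (rule member_le_sum[OF vV _ assms(1)])
    fix i
    have "nonneg_coefs (mono_poly (unit_monom i) * ?s ^ r)"
      using sum_vars_power_in_cone_N[of V r]
      by (intro nonneg_coefs_mult nonneg_coefs_mono) (simp add: nonneg_coefs_def cone_N_def)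
    then show "0 \<le> coef (mono_poly (unit_monom i) * ?s ^ r) \<beta>"
      by (simp add: nonneg_coefs_def)
  qed
  also have "\<dots> = coef (?s ^ Suc r) \<beta>"
    by (simp add: sum_distrib_right lookup_sum var_eq_mono)
  finally show ?case .
qed

lemma sum_vars_power_nonzero:
  assumes "finite V" "V \<noteq> {}"
  shows "(\<Sum>v\<in>V. var v :: 'v rpoly) ^ r \<noteq> 0"
proof -
  have "poly_val (\<lambda>_. 1) ((\<Sum>v\<in>V. var v) ^ r) > 0"
    using assms by (simp add: poly_val_power poly_val_sum card_gt_0_iff)
  then show ?thesis by auto
qed

section \<open>Stable sets and the minimum defining \<open>nu\<close>\<close>

lemma sym_graph_mat: "sym_mat V (graph_mat t G)"
  by (simp add: sym_mat_def graph_mat_def adj_mat_def id_mat_def all_ones_def insert_commute eq_commute)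

lemma simple_graph_no_loop: "simple_graph G \<Longrightarrow> {v} \<notin> edges G"
  by (auto simp: simple_graph_def)

lemma quad_val_stable:
  assumes "finite (verts G)" "stable G S"
  shows "quad_val (verts G) (graph_mat t G) (indicator S) = t * card S - (real (card S))\<^sup>2"
proof -
  have S: "S \<subseteq> verts G" "finite S"
    using assms finite_subset unfolding stable_def by blast+
  have "quad_val (verts G) (graph_mat t G) (indicator S) =
      (\<Sum>i\<in>S. \<Sum>j\<in>S. t * (if i = j then 1 else 0) - 1)"
    unfolding quad_val_def using S assms
    by (intro sum.mono_neutral_cong_right ballI)
      (auto intro!: sum.mono_neutral_cong_right
        simp: graph_mat_def adj_mat_def id_mat_def all_ones_def stable_def indicator_def)
  also have "\<dots> = t * card S - (real (card S))\<^sup>2"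
    using S
    by (simp add: sum_subtractf sum_distrib_left[symmetric] sum.delta power2_eq_square algebra_simps)
  finally show ?thesis .
qed

lemma stable_singleton: "simple_graph G \<Longrightarrow> v \<in> verts G \<Longrightarrow> stable G {v}"
  by (simp add: stable_def simple_graph_no_loop)

text \<open>
  The value at the indicator vector of \<open>S\<close> is \<open>t \<bar>S\<bar> - \<bar>S\<bar>\<^sup>2\<close>.
\<close>

lemma copositive_imp_stable_le:
  assumes G: "simple_graph G"
    and cop: "\<And>x. (\<And>v. x v \<ge> 0) \<Longrightarrow> quad_val (verts G) (graph_mat t G) x \<ge> 0"
    and S: "stable G S" "S \<noteq> {}"
  shows "real (card S) \<le> t"
proof -
  have fin: "finite (verts G)" using G by (simp add: simple_graph_def)
  then have "finite S" using S finite_subset unfolding stable_def by blast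
  then have c: "real (card S) > 0" using S by (simp add: card_gt_0_iff)
  have "0 \<le> t * card S - (real (card S))\<^sup>2"
    using cop[of "indicator S"] quad_val_stable[OF fin S(1), of t] by simp
  then have "real (card S) * card S \<le> t * card S" by (simp add: power2_eq_square)
  then show ?thesis using c by simp
qed

lemma cone_Q_imp_stable_le:
  assumes G: "simple_graph G" and M: "graph_mat t G \<in> cone_Q (verts G) r"
    and S: "stable G S" "S \<noteq> {}"
  shows "real (card S) \<le> t"
proof (rule copositive_imp_stable_le[OF G _ S])
  fix x :: "'a \<Rightarrow> real" assume x: "\<And>v. x v \<ge> 0"
  have "verts G \<noteq> {}" "finite (verts G)"
    using S G by (auto simp: stable_def simple_graph_def)
  then show "0 \<le> quad_val (verts G) (graph_mat t G) x"
    using M by (intro multiplier_imp_copositive[OF _ sum_vars_power_in_cone_N[of _ r] _ sym_graph_mat _ x]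
        sum_vars_power_nonzero) (auto simp: cone_Q_def)
qed

lemma cone_Q_tilde_imp_stable_le:
  assumes G: "simple_graph G" and M: "graph_mat t G \<in> cone_Q_tilde (verts G) r"
    and S: "stable G S" "S \<noteq> {}"
  shows "real (card S) \<le> t"
proof (rule copositive_imp_stable_le[OF G _ S])
  fix x :: "'a \<Rightarrow> real" assume x: "\<And>v. x v \<ge> 0"
  obtain p where p: "p \<in> cone_N (verts G) r" "norm1 p = 1"
      "p * quad_form (verts G) (graph_mat t G) \<in> cone_H (verts G) r"
    using M by (auto simp: cone_Q_tilde_def)
  moreover have "p \<noteq> 0" using p(2) by (auto simp: norm1_def)
  ultimately show "0 \<le> quad_val (verts G) (graph_mat t G) x"
    using G by (intro multiplier_imp_copositive[OF _ p(1) _ sym_graph_mat p(3) x])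
      (auto simp: simple_graph_def)
qed

lemma stable_card_finite: "simple_graph G \<Longrightarrow> finite {card S | S. stable G S}"
  by (rule finite_subset[of _ "card ` Pow (verts G)"]) (auto simp: stable_def simple_graph_def)

lemma stable_le_alpha: "simple_graph G \<Longrightarrow> stable G S \<Longrightarrow> card S \<le> alpha G"
  unfolding alpha_def by (intro Max_ge stable_card_finite) auto

lemma alpha_attained:
  assumes "simple_graph G"
  obtains S where "stable G S" "card S = alpha G"
proof -
  have "stable G {}" by (simp add: stable_def)
  then have "alpha G \<in> {card S | S. stable G S}"
    unfolding alpha_def by (intro Max_in stable_card_finite assms) blast
  then show thesis using that by auto
qed

text \<open>
  The admissible \<open>t\<close> form a closed set, since the coefficients of the polynomial are affine in \<open>t\<close>. It
  is bounded below by 1, the size of a stable singleton, and contains the number \<open>n\<close> of vertices: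
  \<open>n (A + I) - J\<close> is the sum of \<open>n I - J\<close>, which is positive semidefinite, and of the nonnegative matrix \<open>n A\<close>.
\<close>

lemma nu_attained:
  assumes G: "simple_graph G" and ne: "verts G \<noteq> {}"
  shows "graph_mat (nu r G) G \<in> cone_Q (verts G) r"
proof -
  let ?V = "verts G" and ?p = "(\<Sum>v\<in>verts G. var v) ^ r"
  define T where "T = {t. graph_mat t G \<in> cone_Q ?V r}"
  have V: "finite ?V" using G by (simp add: simple_graph_def)
  have T: "t \<in> T \<longleftrightarrow> ?p * quad_form ?V (graph_mat t G) \<in> cone_H ?V r" for t
    by (simp add: T_def cone_Q_def sym_graph_mat)
  obtain v where v: "v \<in> ?V" using ne by blast
  have below: "1 \<le> t" if "t \<in> T" for t
    using cone_Q_imp_stable_le[OF G _ stable_singleton[OF G v], of t r] that by (simp add: T_def)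
  have "real (card ?V) \<in> T"
    unfolding T
  proof (rule mult_quad_form_in_cone_H[OF V sum_vars_power_in_cone_N])
    \<comment> \<open>This is \<open>n I - J\<close>, from the partition into singletons.\<close>
    show "psd ?V (\<lambda>i j. real (card ?V) * (if id i = id j then 1 else 0) - 1)"
      by (rule psd_partition[OF V V]) simp
  qed (simp add: graph_mat_def adj_mat_def id_mat_def all_ones_def)
  moreover have "closed T"
    unfolding closed_sequential_limits
  proof (intro allI impI, elim conjE)
    fix ts t assume ts: "\<forall>n. ts n \<in> T" "ts \<longlonglongrightarrow> t"
    let ?f = "\<lambda>t. ?p * quad_form ?V (graph_mat t G)"
    define A where "A = ?p * quad_form ?V (\<lambda>u v. adj_mat G u v + id_mat u v)"
    define B where "B = ?p * quad_form ?V (\<lambda>u v. - all_ones u v)"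
    have f: "coef (?f t) \<gamma> = t * coef A \<gamma> + coef B \<gamma>" for t \<gamma>
    proof -
      have "quad_form ?V (graph_mat t G) = const_poly t * quad_form ?V (\<lambda>u v. adj_mat G u v + id_mat u v)
          + quad_form ?V (\<lambda>u v. - all_ones u v)"
        unfolding quad_form_scale[symmetric] quad_form_add[symmetric]
        by (simp add: graph_mat_def[abs_def])
      then have "?f t = const_poly t * A + B"
        by (simp add: A_def B_def algebra_simps)
      then show ?thesis by (simp add: lookup_add)
    qed
    show "t \<in> T"
      unfolding T
    proof (rule cone_H_closed[OF V])
      show "?f (ts n) \<in> cone_H ?V r" for n using ts(1) T by blast
      show "?f t \<in> poly_ring ?V"
        by (intro poly_ring_intros quad_form_in_ring)
      show "homogeneous (r + 2) (?f t)"
        using sum_vars_power_in_cone_N[of ?V r]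
        by (intro homogeneous_mult homogeneous_quad_form) (simp add: cone_N_def)
      show "(\<lambda>n. coef (?f (ts n)) \<gamma>) \<longlonglongrightarrow> coef (?f t) \<gamma>" for \<gamma>
        unfolding f by (intro tendsto_intros ts(2))
    qed
  qed
  ultimately have "Inf T \<in> T"
    using below by (intro closed_contains_Inf bdd_belowI[of _ 1]) auto
  moreover have "Inf T \<le> t" if "t \<in> T" for t
    using that below by (intro cInf_lower bdd_belowI[of _ 1]) auto
  ultimately have "nu r G = Inf T"
    unfolding nu_def by (intro Least_equality) (auto simp: T_def)
  then show ?thesis using \<open>Inf T \<in> T\<close> by (simp add: T_def)
qed

lemma alpha_less_nu:
  assumes G: "simple_graph G" and ne: "verts G \<noteq> {}"
    and notin: "graph_mat (alpha G) G \<notin> cone_Q (verts G) r"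
  shows "real (alpha G) < nu r G"
proof -
  obtain S where S: "stable G S" "card S = alpha G"
    using alpha_attained[OF G] .
  obtain v where "v \<in> verts G" using ne by blast
  then have "S \<noteq> {}"
    using stable_le_alpha[OF G stable_singleton[OF G]] S by fastforce
  then have "real (alpha G) \<le> nu r G"
    using cone_Q_imp_stable_le[OF G nu_attained[OF G ne] S(1)] S(2) by simp
  moreover have "nu r G \<noteq> real (alpha G)"
    using nu_attained[OF G ne, of r] notin by auto
  ultimately show ?thesis by simp
qed

text \<open>
  The only multiplier of degree 0 and norm 1 with nonnegative coefficients is the constant 1.
\<close>

lemma nu_tilde_0: "nu_tilde 0 G = nu 0 G"
proof -
  have "p = 1" if "p \<in> cone_N V 0" "norm1 p = 1" for p and V :: "'a set"
  proof -
    have 0: "coef p \<beta> = 0" if "\<beta> \<noteq> 0" for \<beta>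
      using \<open>p \<in> cone_N V 0\<close> that by (intro coef_homogeneous) (auto simp: cone_N_def mdeg_eq_0_iff)
    have "norm1 p = (\<Sum>\<beta>\<in>{0}. \<bar>coef p \<beta>\<bar>)"
      unfolding norm1_def using 0 by (intro sum.mono_neutral_left) (auto simp: in_keys_iff)
    then have "coef p 0 = 1" using that by (auto simp: cone_N_def)
    then show ?thesis using 0 by (intro poly_mapping_eqI) (auto simp: lookup_one when_def)
  qed
  moreover have "1 \<in> cone_N V 0" "norm1 (1 :: 'a rpoly) = 1" for V :: "'a set"
    using sum_vars_power_in_cone_N[of V 0] by (simp_all add: norm1_def)
  ultimately have "(\<exists>p\<in>cone_N V 0. norm1 p = 1 \<and> p * q \<in> cone_H V 0) \<longleftrightarrow> q \<in> cone_H V 0"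
    for V :: "'a set" and q
    by (metis mult_1)
  then have "cone_Q_tilde V 0 = cone_Q V 0" for V :: "'a set"
    unfolding cone_Q_tilde_def cone_Q_def by simp
  then show ?thesis by (simp add: nu_tilde_def nu_def)
qed

section \<open>The graphs \<open>L_graph k\<close>\<close>

text \<open>
  The two kinds of edges, with the unordered pair in the definition of the second kind resolved into its
  ends; the relation between blocks is symmetric.
\<close>

lemma L_edge_cycle_or_block:
  "{u, w} \<in> edges (L_graph k) \<longleftrightarrow>
    (\<exists>i j. (i, j) \<in> L_pairs k \<and>
      {u, w} \<in> {{VS i, VA i j}, {VA i j, VB i j}, {VB i j, VS j}, {VS j, VC i j}, {VC i j, VS i}}) \<or>
    (\<exists>i j l m. (i, j) \<in> L_pairs k \<and> (l, m) \<in> L_pairs k \<and> (i, j) \<noteq> (l, m) \<and>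
      u \<in> L_block i j \<and> w \<in> L_block l m)" (is "_ \<longleftrightarrow> ?cyc \<or> (\<exists>i j l m. ?blk u w i j l m)")
proof -
  have blk: "{u, w} \<in> {{u', w'} | u' w' i j l m. (i, j) \<in> L_pairs k \<and> (l, m) \<in> L_pairs k \<and> (i, j) \<noteq> (l, m) \<and>
            u' \<in> L_block i j \<and> w' \<in> L_block l m} \<longleftrightarrow> (\<exists>i j l m. ?blk u w i j l m)" (is "?l \<longleftrightarrow> ?r")
  proof
    assume ?l
    then show ?r
      unfolding mem_Collect_eq
    proof (elim exE conjE)
      fix u' w' i j l m
      assume "{u, w} = {u', w'}" and a: "(i, j) \<in> L_pairs k" "(l, m) \<in> L_pairs k"
        "(i, j) \<noteq> (l, m)" "u' \<in> L_block i j" "w' \<in> L_block l m"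
      then consider "u = u'" "w = w'" | "u = w'" "w = u'"
        unfolding doubleton_eq_iff by (elim disjE conjE)
      then show ?r
      proof cases
        case 1
        then have "?blk u w i j l m" using a by simp
        then show ?thesis by (intro exI)
      next
        case 2
        then have "?blk u w l m i j" using a by (simp add: eq_commute)
        then show ?thesis by (intro exI)
      qed
    qed
  next
    assume ?r
    then show ?l
      unfolding mem_Collect_eq by (elim exE) (intro exI, rule conjI[OF refl])
  qed
  have cyc: "{u, w} \<in> (\<Union>(i, j)\<in>L_pairs k.
          {{VS i, VA i j}, {VA i j, VB i j}, {VB i j, VS j}, {VS j, VC i j}, {VC i j, VS i}}) \<longleftrightarrow> ?cyc"
    unfolding UN_iff Bex_def split_paired_Ex case_prod_conv ..
  show ?thesis unfolding L_graph_def ugraph.simps Un_iff cyc blk ..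
qed

lemma L_edge_iff:
  "{VS m, VS n} \<in> edges (L_graph k) \<longleftrightarrow> False"
  "{VS m, VA i j} \<in> edges (L_graph k) \<longleftrightarrow> (i, j) \<in> L_pairs k \<and> m = i"
  "{VS m, VB i j} \<in> edges (L_graph k) \<longleftrightarrow> (i, j) \<in> L_pairs k \<and> m = j"
  "{VS m, VC i j} \<in> edges (L_graph k) \<longleftrightarrow> (i, j) \<in> L_pairs k \<and> (m = i \<or> m = j)"
  "{VA i j, VA l m} \<in> edges (L_graph k) \<longleftrightarrow> (i, j) \<in> L_pairs k \<and> (l, m) \<in> L_pairs k \<and> (i, j) \<noteq> (l, m)"
  "{VA i j, VB l m} \<in> edges (L_graph k) \<longleftrightarrow> (i, j) \<in> L_pairs k \<and> (l, m) \<in> L_pairs k"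
  "{VA i j, VC l m} \<in> edges (L_graph k) \<longleftrightarrow> (i, j) \<in> L_pairs k \<and> (l, m) \<in> L_pairs k \<and> (i, j) \<noteq> (l, m)"
  "{VB i j, VB l m} \<in> edges (L_graph k) \<longleftrightarrow> (i, j) \<in> L_pairs k \<and> (l, m) \<in> L_pairs k \<and> (i, j) \<noteq> (l, m)"
  "{VB i j, VC l m} \<in> edges (L_graph k) \<longleftrightarrow> (i, j) \<in> L_pairs k \<and> (l, m) \<in> L_pairs k \<and> (i, j) \<noteq> (l, m)"
  "{VC i j, VC l m} \<in> edges (L_graph k) \<longleftrightarrow> (i, j) \<in> L_pairs k \<and> (l, m) \<in> L_pairs k \<and> (i, j) \<noteq> (l, m)"
  by (simp_all add: L_edge_cycle_or_block L_block_def doubleton_eq_iff) blast+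

lemma L_edge_iff':
  "{VA i j, VS m} \<in> edges (L_graph k) \<longleftrightarrow> (i, j) \<in> L_pairs k \<and> m = i"
  "{VB i j, VS m} \<in> edges (L_graph k) \<longleftrightarrow> (i, j) \<in> L_pairs k \<and> m = j"
  "{VC i j, VS m} \<in> edges (L_graph k) \<longleftrightarrow> (i, j) \<in> L_pairs k \<and> (m = i \<or> m = j)"
  "{VB l m, VA i j} \<in> edges (L_graph k) \<longleftrightarrow> (i, j) \<in> L_pairs k \<and> (l, m) \<in> L_pairs k"
  "{VC l m, VA i j} \<in> edges (L_graph k) \<longleftrightarrow> (i, j) \<in> L_pairs k \<and> (l, m) \<in> L_pairs k \<and> (i, j) \<noteq> (l, m)"
  "{VC l m, VB i j} \<in> edges (L_graph k) \<longleftrightarrow> (i, j) \<in> L_pairs k \<and> (l, m) \<in> L_pairs k \<and> (i, j) \<noteq> (l, m)"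
  by (simp_all only: insert_commute[of _ _ "{}"] L_edge_iff)

lemma L_vert_iff:
  "VS m \<in> verts (L_graph k) \<longleftrightarrow> m \<in> {1..k}"
  "VA i j \<in> verts (L_graph k) \<longleftrightarrow> (i, j) \<in> L_pairs k"
  "VB i j \<in> verts (L_graph k) \<longleftrightarrow> (i, j) \<in> L_pairs k"
  "VC i j \<in> verts (L_graph k) \<longleftrightarrow> (i, j) \<in> L_pairs k"
  unfolding verts_L_graph L_block_def by auto

lemma L_pairs_less: "(i, j) \<in> L_pairs k \<Longrightarrow> i < j"
  by (simp add: L_pairs_def)

lemma finite_verts_L_graph: "finite (verts (L_graph k))"
  using simple_graph_L_graph by (simp add: simple_graph_def)

section \<open>Lower bound: powers of the sum of the variables\<close>

text \<open>
  The pairs are exactly the five nonadjacent pairs of the 5-cycle, listed so that consecutive ones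
  share a vertex.
\<close>

lemma stable_hubs_and_pair:
  assumes ij: "(i, j) \<in> L_pairs k"
    and uv: "(u, v) \<in> {(VS i, VB i j), (VB i j, VC i j), (VC i j, VA i j), (VA i j, VS j), (VS j, VS i)}"
  defines "S \<equiv> insert u (insert v (VS ` ({1..k} - {i, j})))"
  shows "stable (L_graph k) S" "card S = k"
proof -
  have i: "1 \<le> i" "i < j" "j \<le> k" using ij by (auto simp: L_pairs_def)
  show "stable (L_graph k) S"
    unfolding stable_def S_def using uv i ij
    by (elim insertE emptyE) (auto simp: L_vert_iff L_edge_iff L_edge_iff' simple_graph_no_loop[OF simple_graph_L_graph])
  have "card (VS ` ({1..k} - {i, j})) = k - 2"
    using i by (subst card_image) (auto simp: inj_on_def card_Diff_subset)
  moreover have "u \<notin> insert v (VS ` ({1..k} - {i, j}))" "v \<notin> VS ` ({1..k} - {i, j})"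
    using uv i by auto
  ultimately show "card S = k" unfolding S_def using i by simp
qed

text \<open>
  Modulo the kernel of \<open>P\<close>, any two consecutive vertices \<open>u\<close>, \<open>v\<close> of the closed walk \<open>s, b, c, a, s'\<close> satisfy
  \<open>u + v = - R\<close>. As the length 5 is odd, the alternating sum of these equations determines every vertex:
  each is \<open>- R / 2\<close>. Therefore \<open>P s s' = P(R) / 4\<close>.
\<close>

lemma five_cycle_entry_nonneg:
  assumes V: "finite V" and P: "psd V P"
    and mem: "s \<in> V" "s' \<in> V"
    and notin: "s \<notin> R" "a \<notin> R" "b \<notin> R" "s' \<notin> R" "c \<notin> R"
    and dist: "s \<noteq> b" "b \<noteq> c" "c \<noteq> a" "a \<noteq> s'" "s' \<noteq> s"
    and ker: "\<And>u v y. (u, v) \<in> {(s, b), (b, c), (c, a), (a, s'), (s', s)} \<Longrightarrow>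
      bilin V P (indicator (insert u (insert v R))) y = 0"
  shows "P s s' \<ge> 0"
proof -
  define h where "h u y = bilin V P (indicator {u}) y" for u y
  define \<rho> where "\<rho> y = bilin V P (indicator R) y" for y
  have sym: "sym_mat V P" using P by (simp add: psd_def)
  have sum: "h u y + h v y + \<rho> y = 0"
    if "(u, v) \<in> {(s, b), (b, c), (c, a), (a, s'), (s', s)}" for u v y
  proof -
    have "u \<noteq> v" "u \<notin> R" "v \<notin> R" using that notin dist by auto
    then have "indicator (insert u (insert v R)) = (\<lambda>z. (indicator {u} z + indicator {v} z) + indicator R z :: real)"
      by (auto simp: indicator_def fun_eq_iff)
    then show ?thesis
      using ker[OF that, of y] unfolding h_def \<rho>_def by (simp add: bilin_add_left)
  qed
  have "h s y = - \<rho> y / 2" "h s' y = - \<rho> y / 2" for y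
    using sum[of s b y] sum[of b c y] sum[of c a y] sum[of a s' y] sum[of s' s y] by simp_all
  then have "P s s' = - \<rho> (indicator {s'}) / 2" and "h s' (indicator R) = - \<rho> (indicator R) / 2"
    using bilin_unit[OF V mem, of P] by (simp_all add: h_def)
  moreover have "\<rho> (indicator {s'}) = h s' (indicator R)"
    unfolding \<rho>_def h_def by (rule bilin_commute[OF sym])
  ultimately have "P s s' = \<rho> (indicator R) / 4" by simp
  moreover have "0 \<le> \<rho> (indicator R)"
    using P by (simp add: \<rho>_def bilin_self psd_def)
  ultimately show ?thesis by simp
qed

text \<open>
  The coefficients of \<open>\<gamma> = s\<^sub>1 \<cdots> s\<^bsub>r+2\<^esub>\<close> are compared. A decomposition \<open>\<gamma> = \<beta> + u + w\<close> is only possible with distinct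
  \<open>u = s\<^sub>m\<close>, \<open>w = s\<^sub>n\<close> outside the support of \<open>\<beta>\<close>, because \<open>\<gamma>\<close> is squarefree. Such entries of \<open>P\<^sub>\<beta>\<close> are nonnegative by
  the argument on the 5-cycle of the pair, whereas the entry of the matrix is -1 as \<open>s\<^sub>m\<close>, \<open>s\<^sub>n\<close> are not adjacent.
\<close>

lemma L_graph_mat_notin_cone_Q:
  assumes r: "r + 2 \<le> k"
  shows "graph_mat (real k) (L_graph k) \<notin> cone_Q (verts (L_graph k)) r"
proof
  let ?V = "verts (L_graph k)" and ?M = "graph_mat (real k) (L_graph k)"
  let ?p = "(\<Sum>v\<in>?V. var v) ^ r"
  define f where "f = ?p * quad_form ?V ?M"
  have V: "finite ?V" by (rule finite_verts_L_graph)
  assume "?M \<in> cone_Q ?V r"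
  then have "f \<in> cone_H ?V r" by (simp add: cone_Q_def f_def)
  from cone_H_imp_gram[OF V this] obtain P where
    P: "\<And>\<beta>. \<beta> \<in> monoms ?V r \<Longrightarrow> psd ?V (P \<beta>)"
    and le: "\<And>\<gamma>. coef (gram_poly ?V r P) \<gamma> \<le> coef f \<gamma>" by blast
  have entry: "P \<beta> (VS i) (VS j) \<ge> 0"
    if b: "\<beta> \<in> monoms ?V r" "Poly_Mapping.keys \<beta> \<subseteq> VS ` ({1..k} - {i, j})"
      and ij: "(i, j) \<in> L_pairs k" for \<beta> i j
  proof (rule five_cycle_entry_nonneg[OF V P[OF b(1)], where a="VA i j" and b="VB i j" and c="VC i j"
        and R="VS ` ({1..k} - {i, j})"])
    fix u v y
    assume uv: "(u, v) \<in> {(VS i, VB i j), (VB i j, VC i j), (VC i j, VA i j), (VA i j, VS j), (VS j, VS i)}"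
    define S where "S = insert u (insert v (VS ` ({1..k} - {i, j})))"
    have S: "stable (L_graph k) S" "card S = k"
      unfolding S_def using stable_hubs_and_pair[OF ij uv] by auto
    have "bilin ?V (P \<beta>) (indicator S) y = 0"
    proof (rule gram_kernel[OF V P le _ _ b(1)])
      show "poly_val (indicator S) f = 0"
        using quad_val_stable[OF V S(1), of "real k"] S(2)
        by (simp add: f_def poly_val_mult poly_val_quad_form power2_eq_square)
      have "monom_val (indicator S) \<beta> = 1"
        unfolding monom_val_def using b(2) by (intro prod.neutral) (auto simp: S_def indicator_def)
      then show "0 < monom_val (indicator S) \<beta>" by simp
    qed simp_all
    then show "bilin ?V (P \<beta>) (indicator (insert u (insert v (VS ` ({1..k} - {i, j}))))) y = 0"
      by (simp add: S_def)
  qed (use ij in \<open>auto simp: L_vert_iff L_pairs_def\<close>)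
  define \<gamma> where "\<gamma> = (\<Sum>m\<in>{1..r+2}. unit_monom (VS m))"
  have \<gamma>: "Poly_Mapping.lookup \<gamma> v = (if v \<in> VS ` {1..r+2} then 1 else 0)" for v
  proof -
    have "Poly_Mapping.lookup \<gamma> v = (\<Sum>m\<in>{1..r+2}. if VS m = v then 1 else 0)"
      unfolding \<gamma>_def lookup_sum by (intro sum.cong) (auto simp: lookup_single when_def)
    then show ?thesis by (cases v) (auto simp: sum.delta)
  qed
  have split: "\<exists>m n. u = VS m \<and> w = VS n \<and> m \<noteq> n \<and> m \<in> {1..k} \<and> n \<in> {1..k} \<and>
      Poly_Mapping.keys \<beta> \<subseteq> VS ` ({1..k} - {m, n})"
    if eq: "\<gamma> = \<beta> + unit_monom u + unit_monom w" for \<beta> u w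
  proof -
    have l: "Poly_Mapping.lookup \<beta> v + (if v = u then 1 else 0) + (if v = w then 1 else 0)
        = (if v \<in> VS ` {1..r+2} then 1 else 0)" for v
      unfolding \<gamma>[of v, symmetric] eq by (auto simp: lookup_add lookup_single when_def)
    have u: "u \<in> VS ` {1..r+2}" "u \<noteq> w" "Poly_Mapping.lookup \<beta> u = 0"
      using l[of u] by (auto split: if_splits)
    have w: "w \<in> VS ` {1..r+2}" "Poly_Mapping.lookup \<beta> w = 0"
      using l[of w] by (auto split: if_splits)
    have "v \<in> VS ` {1..k} - {u, w}" if "v \<in> Poly_Mapping.keys \<beta>" for v
      using l[of v] that u w r by (auto simp: in_keys_iff split: if_splits)
    then show ?thesis using u w r by fastforce
  qed
  have "0 \<le> coef (gram_poly ?V r P) \<gamma>"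
    unfolding coef_gram_poly
  proof (intro sum_nonneg, clarify)
    fix \<beta> u w assume b: "\<beta> \<in> monoms ?V r"
    show "0 \<le> P \<beta> u w * (if \<gamma> = \<beta> + unit_monom u + unit_monom w then 1 else 0)"
    proof (cases "\<gamma> = \<beta> + unit_monom u + unit_monom w")
      case True
      from split[OF this] obtain m n where mn: "u = VS m" "w = VS n" "m \<noteq> n" "m \<in> {1..k}" "n \<in> {1..k}"
        "Poly_Mapping.keys \<beta> \<subseteq> VS ` ({1..k} - {m, n})" by blast
      have "0 \<le> P \<beta> (VS m) (VS n)"
      proof (cases "m < n")
        case True
        then show ?thesis using mn by (intro entry b) (auto simp: L_pairs_def)
      next
        case False
        then have "0 \<le> P \<beta> (VS n) (VS m)"
          using mn by (intro entry b) (auto simp: L_pairs_def insert_commute)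
        then show ?thesis
          using P[OF b] mn by (auto simp: psd_def sym_mat_def L_vert_iff)
      qed
      then show ?thesis using mn by simp
    qed simp
  qed
  also have "\<dots> \<le> coef f \<gamma>" by (rule le)
  also have "\<dots> < 0"
  proof -
    let ?t = "\<lambda>(\<beta>, u, w). - (coef ?p \<beta> * ?M u w * (if \<gamma> = \<beta> + unit_monom u + unit_monom w then 1 else 0))"
    have p: "?p \<in> cone_N ?V r" by (rule sum_vars_power_in_cone_N)
    have ent: "?M u w = -1" if "\<gamma> = \<beta> + unit_monom u + unit_monom w" for \<beta> u w
      using split[OF that] by (auto simp: graph_mat_def adj_mat_def id_mat_def all_ones_def L_edge_iff)
    have "0 < (\<Sum>z\<in>monoms ?V r \<times> ?V \<times> ?V. ?t z)"
    proof (rule sum_pos2)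
      \<comment> \<open>All terms are nonnegative, so one positive term suffices: \<open>\<beta> = s\<^sub>3 \<cdots> s\<^bsub>r+2\<^esub>\<close> with \<open>u = s\<^sub>1\<close>, \<open>w = s\<^sub>2\<close>.\<close>
      let ?z = "(\<Sum>m\<in>{3..r+2}. unit_monom (VS m), VS 1, VS 2)"
      have dec: "\<gamma> = (\<Sum>m\<in>{3..r+2}. unit_monom (VS m)) + unit_monom (VS 1) + unit_monom (VS 2)"
      proof -
        have "{1..r+2} = insert 1 (insert 2 {3..r+2})" by auto
        then show ?thesis by (simp add: \<gamma>_def ac_simps)
      qed
      have "mdeg \<gamma> = r + 2"
      proof -
        have "mdeg (\<Sum>m\<in>A. unit_monom (VS m)) = card A" if "finite A" for A
          using that by (induction A) auto
        then show ?thesis by (simp add: \<gamma>_def)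
      qed
      then have mon: "(\<Sum>m\<in>{3..r+2}. unit_monom (VS m)) \<in> monoms ?V r"
        using split[OF dec] unfolding dec by (auto simp: monoms_def L_vert_iff)
      show "?z \<in> monoms ?V r \<times> ?V \<times> ?V"
        using mon r by (auto simp: L_vert_iff)
      show "0 < ?t ?z"
        using coef_sum_vars_power_pos[OF V mon] ent[OF dec] dec by simp
      show "0 \<le> ?t z" if "z \<in> monoms ?V r \<times> ?V \<times> ?V" for z
        using p ent by (auto simp: cone_N_def split: prod.splits)
    qed (use finite_monoms[OF V] V in auto)
    also have "\<dots> = - coef f \<gamma>"
      using p unfolding f_def
      by (subst mult_quad_form_eq_gram[OF V])
        (auto simp: cone_N_def coef_gram_poly split_def sum_negf)
    finally show ?thesis by simp
  qed
  finally show False by simp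
qed

section \<open>Upper bound: a linear multiplier\<close>

text \<open>
  The monomial \<open>x\<^sub>v x\<^sub>i x\<^sub>j\<close> with \<open>v\<close>, \<open>i\<close> in \<open>T\<close> and \<open>j\<close> outside \<open>T\<close> arises from \<open>E v\<close> and from \<open>E i\<close>; a negative entry
  of one may be compensated by the other.
\<close>

lemma nonneg_coefs_symmetrized_cubic:
  assumes V: "finite V" "T \<subseteq> V"
    and sym: "\<And>v i j. v \<in> T \<Longrightarrow> i \<in> V \<Longrightarrow> j \<in> V \<Longrightarrow> E v i j = E v j i"
    and same: "\<And>v i j. v \<in> T \<Longrightarrow> i \<in> V \<Longrightarrow> j \<in> V \<Longrightarrow> (i \<in> T \<longleftrightarrow> j \<in> T) \<Longrightarrow> E v i j \<ge> 0"
    and mixed: "\<And>v i j. v \<in> T \<Longrightarrow> i \<in> T \<Longrightarrow> j \<in> V - T \<Longrightarrow> E v i j + E i v j \<ge> 0"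
  shows "nonneg_coefs (\<Sum>v\<in>T. var v * quad_form V (E v))"
proof -
  let ?U = "V - T"
  define t where "t v i j = const_poly (E v i j) * (var v * (var i * var j))" for v i j
  define S where "S = (\<Sum>v\<in>T. \<Sum>i\<in>T. \<Sum>j\<in>?U. t v i j)"
  have fin: "finite T" "finite ?U" using V finite_subset by auto
  have V_eq: "V = T \<union> ?U" using V by auto
  have split: "(\<Sum>i\<in>V. g i) = (\<Sum>i\<in>T. g i) + (\<Sum>i\<in>?U. g i)" for g :: "'a \<Rightarrow> 'a rpoly"
    by (subst V_eq, rule sum.union_disjoint) (use fin in auto)
  have "(\<Sum>v\<in>T. var v * quad_form V (E v)) = (\<Sum>v\<in>T. \<Sum>i\<in>V. \<Sum>j\<in>V. t v i j)"
    by (simp add: quad_form_def sum_distrib_left t_def mult_ac)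
  also have "\<dots> = (\<Sum>v\<in>T. \<Sum>i\<in>T. \<Sum>j\<in>T. t v i j) + S + (\<Sum>v\<in>T. \<Sum>i\<in>?U. \<Sum>j\<in>T. t v i j)
      + (\<Sum>v\<in>T. \<Sum>i\<in>?U. \<Sum>j\<in>?U. t v i j)"
    unfolding S_def by (simp add: split sum.distrib add.assoc)
  also have "(\<Sum>v\<in>T. \<Sum>i\<in>?U. \<Sum>j\<in>T. t v i j) = S"
    unfolding S_def
  proof (rule sum.cong[OF refl])
    fix v assume v: "v \<in> T"
    have "(\<Sum>i\<in>?U. \<Sum>j\<in>T. t v i j) = (\<Sum>j\<in>T. \<Sum>i\<in>?U. t v i j)" by (rule sum.swap)
    also have "\<dots> = (\<Sum>j\<in>T. \<Sum>i\<in>?U. t v j i)"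
      using V v by (intro sum.cong) (auto simp: t_def sym mult_ac)
    finally show "(\<Sum>i\<in>?U. \<Sum>j\<in>T. t v i j) = (\<Sum>j\<in>T. \<Sum>i\<in>?U. t v j i)" .
  qed
  also have "(\<Sum>v\<in>T. \<Sum>i\<in>T. \<Sum>j\<in>T. t v i j) + S + S + (\<Sum>v\<in>T. \<Sum>i\<in>?U. \<Sum>j\<in>?U. t v i j) =
      (\<Sum>v\<in>T. \<Sum>i\<in>T. \<Sum>j\<in>T. t v i j) + (\<Sum>v\<in>T. \<Sum>i\<in>T. \<Sum>j\<in>?U. t v i j + t i v j)
      + (\<Sum>v\<in>T. \<Sum>i\<in>?U. \<Sum>j\<in>?U. t v i j)"
  proof -
    have "S = (\<Sum>v\<in>T. \<Sum>i\<in>T. \<Sum>j\<in>?U. t i v j)"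
      unfolding S_def by (rule sum.swap)
    then have "S + S = (\<Sum>v\<in>T. \<Sum>i\<in>T. \<Sum>j\<in>?U. t v i j + t i v j)"
      unfolding S_def by (simp add: sum.distrib)
    then show ?thesis by (simp add: add.assoc)
  qed
  finally have eq: "(\<Sum>v\<in>T. var v * quad_form V (E v)) =
      (\<Sum>v\<in>T. \<Sum>i\<in>T. \<Sum>j\<in>T. t v i j) + (\<Sum>v\<in>T. \<Sum>i\<in>T. \<Sum>j\<in>?U. t v i j + t i v j)
      + (\<Sum>v\<in>T. \<Sum>i\<in>?U. \<Sum>j\<in>?U. t v i j)" .
  have t_nn: "nonneg_coefs (t v i j)" if "E v i j \<ge> 0" for v i j
    using that unfolding t_def
    by (intro nonneg_coefs_mult nonneg_coefs_const nonneg_coefs_var)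
  have tt: "t v i j + t i v j = const_poly (E v i j + E i v j) * (var v * (var i * var j))" for v i j
    by (simp add: t_def algebra_simps flip: const_poly_add)
  have "nonneg_coefs (t v i j + t i v j)" if "v \<in> T" "i \<in> T" "j \<in> ?U" for v i j
    unfolding tt using mixed[OF that]
    by (intro nonneg_coefs_mult nonneg_coefs_const nonneg_coefs_var)
  then have "nonneg_coefs (\<Sum>v\<in>T. \<Sum>i\<in>T. \<Sum>j\<in>?U. t v i j + t i v j)"
    by (intro nonneg_coefs_sum)
  moreover have "nonneg_coefs (\<Sum>v\<in>T. \<Sum>i\<in>T. \<Sum>j\<in>T. t v i j)"
    using V by (intro nonneg_coefs_sum t_nn same) auto
  moreover have "nonneg_coefs (\<Sum>v\<in>T. \<Sum>i\<in>?U. \<Sum>j\<in>?U. t v i j)"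
    using V by (intro nonneg_coefs_sum t_nn same) auto
  ultimately show ?thesis
    unfolding eq by (intro nonneg_coefs_add)
qed

text \<open>
  The vertices \<open>a\<^sub>i\<^sub>j\<close> and \<open>b\<^sub>i\<^sub>j\<close>, the inner vertices of the path \<open>s\<^sub>i, a\<^sub>i\<^sub>j, b\<^sub>i\<^sub>j, s\<^sub>j\<close>. Any two of them are adjacent. Their
  variables make up the multiplier.
\<close>

definition L_path_verts :: "nat \<Rightarrow> lvertex set" where
  "L_path_verts k = (\<Union>(i, j)\<in>L_pairs k. {VA i j, VB i j})"

fun L_pair :: "lvertex \<Rightarrow> nat \<times> nat" where
  "L_pair (VA i j) = (i, j)"
| "L_pair (VB i j) = (i, j)"
| "L_pair (VC i j) = (i, j)"
| "L_pair (VS m) = (0, 0)"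

text \<open>
  For a vertex of the path \<open>s\<^sub>i, a\<^sub>i\<^sub>j, b\<^sub>i\<^sub>j, s\<^sub>j\<close>, the index of its neighbour among the hubs \<open>s\<^sub>i\<close>, \<open>s\<^sub>j\<close>, and the
  index of the other hub.
\<close>

fun near_hub :: "lvertex \<Rightarrow> nat" where
  "near_hub (VA i j) = i"
| "near_hub (VB i j) = j"
| "near_hub u = 0"

fun far_hub :: "lvertex \<Rightarrow> nat" where
  "far_hub (VA i j) = j"
| "far_hub (VB i j) = i"
| "far_hub u = 0"

text \<open>
  The partition of the vertices that belongs to the path vertex \<open>v\<close>; the part \<open>m\<close> contains the hub \<open>s\<^sub>m\<close>. In the
  block of \<open>v\<close> both path vertices go to the hub next to \<open>v\<close> and the third vertex \<open>c\<close> to the opposite hub, as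
  in a 5-cycle, where this yields the parts \<open>{s, a, b}\<close> and \<open>{s', c}\<close>. In any other block, \<open>a\<^sub>i\<^sub>j\<close> and \<open>b\<^sub>i\<^sub>j\<close>
  go to their own neighbours. The vertex \<open>c\<^sub>i\<^sub>j\<close> is adjacent to \<open>s\<^sub>i\<close> and \<open>s\<^sub>j\<close> but joins one of \<open>a\<^sub>i\<^sub>j\<close>, \<open>b\<^sub>i\<^sub>j\<close> in a
  part either way. If \<open>v\<close> is next to \<open>s\<^sub>i\<close> or \<open>s\<^sub>j\<close>, it has to go to that same hub, since the
  compensation by the partition of the path vertex it joins needs \<open>v\<close> and \<open>c\<^sub>i\<^sub>j\<close> in different parts there.
\<close>

fun L_part :: "lvertex \<Rightarrow> lvertex \<Rightarrow> nat" where
  "L_part v (VS m) = m"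
| "L_part v (VA i j) = (if (i, j) = L_pair v then near_hub v else i)"
| "L_part v (VB i j) = (if (i, j) = L_pair v then near_hub v else j)"
| "L_part v (VC i j) = (if (i, j) = L_pair v then far_hub v else if near_hub v = j then j else i)"

lemma L_path_verts_cases:
  assumes "v \<in> L_path_verts k"
  obtains (A) i j where "(i, j) \<in> L_pairs k" "v = VA i j"
    | (B) i j where "(i, j) \<in> L_pairs k" "v = VB i j"
  using assms unfolding L_path_verts_def by auto

lemma L_path_verts_iff:
  "VS m \<in> L_path_verts k \<longleftrightarrow> False"
  "VA i j \<in> L_path_verts k \<longleftrightarrow> (i, j) \<in> L_pairs k"
  "VB i j \<in> L_path_verts k \<longleftrightarrow> (i, j) \<in> L_pairs k"
  "VC i j \<in> L_path_verts k \<longleftrightarrow> False"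
  by (auto simp: L_path_verts_def)

lemma L_part_range:
  assumes "v \<in> L_path_verts k" "u \<in> verts (L_graph k)"
  shows "L_part v u \<in> {1..k}"
  using assms(1)
  by (cases rule: L_path_verts_cases; use assms(2) in \<open>cases u\<close>)
    (auto simp: L_vert_iff L_pairs_def)

text \<open>
  Up to the factor \<open>k\<close>, the difference between \<open>M\<close> and the positive semidefinite matrix of the partition:
  1 at edges between the parts, -1 at nonadjacent pairs inside the parts, 0 otherwise.
\<close>

definition part_defect :: "nat \<Rightarrow> lvertex \<Rightarrow> lvertex mat" where
  "part_defect k v i j = adj_mat (L_graph k) i j + id_mat i j - (if L_part v i = L_part v j then 1 else 0)"

text \<open>
  All path vertices are mutually adjacent, and so are all vertices \<open>c\<close>, each of which lies in the part
  of one of its neighbouring hubs.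
\<close>

lemma part_defect_same:
  assumes v: "v \<in> L_path_verts k"
    and i: "i \<in> verts (L_graph k)" and j: "j \<in> verts (L_graph k)"
    and ij: "i \<in> L_path_verts k \<longleftrightarrow> j \<in> L_path_verts k"
  shows "part_defect k v i j \<ge> 0"
proof (cases "i \<in> L_path_verts k")
  case True
  with ij have "j \<in> L_path_verts k" by simp
  with True have "adj_mat (L_graph k) i j + id_mat i j \<ge> 1"
    by (elim L_path_verts_cases) (auto simp: adj_mat_def id_mat_def L_edge_iff L_edge_iff')
  then show ?thesis by (simp add: part_defect_def)
next
  case False
  then show ?thesis
    using v i j ij
    by (cases i; cases j; elim L_path_verts_cases)
      (auto simp: part_defect_def adj_mat_def id_mat_def L_vert_iff L_edge_iff L_edge_iff'
        L_path_verts_iff)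
qed

lemma L_part_path_vert:
  assumes "v \<in> L_path_verts k" "u \<in> L_path_verts k"
  shows "L_part v u = (if L_pair u = L_pair v then near_hub v else near_hub u)"
  using assms by (elim L_path_verts_cases) auto

lemma hubs_of_path_vert:
  assumes "v \<in> L_path_verts k"
  shows "near_hub v \<noteq> far_hub v"
    and "L_pair v = (near_hub v, far_hub v) \<or> L_pair v = (far_hub v, near_hub v)"
  using assms by (auto elim!: L_path_verts_cases dest: L_pairs_less)

lemma adj_path_vert_VC:
  assumes "u \<in> L_path_verts k" "(l, m) \<in> L_pairs k"
  shows "adj_mat (L_graph k) u (VC l m) = (if L_pair u = (l, m) then 0 else 1)"
  using assms by (auto elim!: L_path_verts_cases simp: adj_mat_def L_edge_iff)

text \<open>
  For \<open>j = c\<^sub>l\<^sub>m\<close> the left-hand side counts those of \<open>v\<close>, \<open>i\<close> that are outside the block of \<open>j\<close>, as these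
  are its neighbours among them, minus the number of the two partitions that put \<open>j\<close> together with the
  respective other vertex. If both are outside, this is at least 0. If both are in the block, \<open>j\<close> is on the far side in both partitions.
  If just one is, say \<open>v\<close>, only one partition can put \<open>j\<close> together with the other vertex: the
  partition of \<open>v\<close> if \<open>i\<close> is near the far hub of \<open>v\<close>, in which case the partition of \<open>i\<close> sends \<open>j\<close> to
  that hub as well, away from \<open>v\<close>.
\<close>

lemma part_defect_mixed:
  assumes v: "v \<in> L_path_verts k" and i: "i \<in> L_path_verts k"
    and j: "j \<in> verts (L_graph k) - L_path_verts k"
  shows "part_defect k v i j + part_defect k i v j \<ge> 0"
proof (cases j)
  case (VS m)
  then show ?thesis using v i
    by (elim L_path_verts_cases)
      (auto simp: part_defect_def adj_mat_def id_mat_def L_edge_iff L_edge_iff' L_pairs_def)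
next
  case (VC l m)
  then have lm: "(l, m) \<in> L_pairs k" using j by (simp add: L_vert_iff)
  have j_ne: "v \<noteq> j" "i \<noteq> j" using v i j by auto
  let ?eq = "\<lambda>v i. if L_part v i = L_part v j then 1 else 0 :: real"
  have "part_defect k v i j + part_defect k i v j =
      (if L_pair v = (l, m) then 0 else 1) + (if L_pair i = (l, m) then 0 else 1) - (?eq v i + ?eq i v)"
    using adj_path_vert_VC[OF v lm] adj_path_vert_VC[OF i lm] j_ne VC
    by (simp add: part_defect_def id_mat_def)
  moreover have one: "?eq v i + ?eq i v \<le> 1"
    if "v \<in> L_path_verts k" "i \<in> L_path_verts k" "L_pair v = (l, m)" "L_pair i \<noteq> (l, m)" for v i
    using hubs_of_path_vert[OF that(1)] that L_part_path_vert[OF that(1,2)] L_part_path_vert[OF that(2,1)] VC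
    by auto
  moreover have "?eq v i + ?eq i v = 0" if "L_pair v = (l, m)" "L_pair i = (l, m)"
    using hubs_of_path_vert(1)[OF v] hubs_of_path_vert(1)[OF i] that
      L_part_path_vert[OF v i] L_part_path_vert[OF i v] VC by simp
  ultimately show ?thesis
    using one[OF v i] one[OF i v] by (cases "L_pair v = (l, m)"; cases "L_pair i = (l, m)") simp_all
qed (use j in \<open>auto simp: L_vert_iff L_path_verts_iff\<close>)

text \<open>
  The multiplier is the average of the variables of the path vertices, and the matrix for the variable of \<open>v\<close> is that of
  the partition of \<open>v\<close>. What remains is \<open>\<Sum>\<^sub>v x\<^sub>v x\<^sup>T E\<^sub>v x\<close> up to a positive factor, with \<open>E\<^sub>v\<close> the defect
  of the partition of \<open>v\<close>.
\<close>

lemma L_graph_mat_in_cone_Q_tilde_1: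
  assumes k: "k \<ge> 2"
  shows "graph_mat (real k) (L_graph k) \<in> cone_Q_tilde (verts (L_graph k)) 1"
proof -
  let ?V = "verts (L_graph k)" and ?T = "L_path_verts k" and ?M = "graph_mat (real k) (L_graph k)"
  have V: "finite ?V" by (rule finite_verts_L_graph)
  have TV: "?T \<subseteq> ?V" by (auto simp: L_path_verts_def L_vert_iff)
  then have T: "finite ?T" using V finite_subset by blast
  have "VA 1 2 \<in> ?T" using k by (simp add: L_path_verts_iff L_pairs_def)
  then have cT: "card ?T > 0" using T by (auto simp: card_gt_0_iff)
  define w where "w = 1 / real (card ?T)"
  have w: "w > 0" using cT by (simp add: w_def)
  define p where "p = const_poly w * (\<Sum>v\<in>?T. var v)"
  have p_nn: "nonneg_coefs p"
    unfolding p_def using w by (intro nonneg_coefs_mult nonneg_coefs_const nonneg_coefs_sum nonneg_coefs_var) simp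
  have p_ring: "p \<in> poly_ring ?V"
    unfolding p_def using TV by (intro poly_ring_intros) auto
  have p_hom: "homogeneous 1 p"
    unfolding p_def using homogeneous_mult[OF homogeneous_const homogeneous_sum[OF homogeneous_var]] by simp
  have "norm1 p = 1"
    unfolding norm1_eq_poly_val[OF p_nn] using cT by (simp add: p_def poly_val_mult poly_val_sum w_def)
  moreover have "p \<in> cone_N ?V 1"
    using p_nn p_ring p_hom by (simp add: cone_N_def nonneg_coefs_def)
  moreover have "p * quad_form ?V ?M \<in> cone_H ?V 1"
  proof -
    define Q where "Q v i j = real (card {1..k}) * (if L_part v i = L_part v j then 1 else 0) - 1" for v i j
    define R where "R v i j = (if v \<in> ?T then w * Q v i j else 0)" for v i j
    show ?thesis
    proof (rule linear_multiplier_in_cone_H[OF V])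
      show "p * quad_form ?V ?M \<in> poly_ring ?V"
        by (intro poly_ring_mult p_ring quad_form_in_ring)
      show "homogeneous 3 (p * quad_form ?V ?M)"
        using homogeneous_mult[OF p_hom homogeneous_quad_form, of ?V ?M] by (simp add: numeral_3_eq_3)
      fix v
      have "psd ?V (Q v)" if "v \<in> ?T"
        unfolding Q_def[abs_def] using L_part_range[OF that] by (intro psd_partition V) auto
      then show "psd ?V (R v)"
        unfolding R_def[abs_def] using w by (cases "v \<in> ?T") (auto intro: psd_scale psd_0)
    next
      have R_sum: "(\<Sum>v\<in>?V. var v * quad_form ?V (R v)) = (\<Sum>v\<in>?T. var v * quad_form ?V (\<lambda>i j. w * Q v i j))"
        using V TV by (intro sum.mono_neutral_cong_right) (auto simp: R_def[abs_def] quad_form_0)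
      have pM: "p * quad_form ?V ?M = (\<Sum>v\<in>?T. var v * quad_form ?V (\<lambda>i j. w * ?M i j))"
        by (simp add: p_def quad_form_scale sum_distrib_left sum_distrib_right mult_ac)
      have split: "quad_form ?V (\<lambda>i j. w * ?M i j) = quad_form ?V (\<lambda>i j. w * Q v i j)
          + const_poly (w * real k) * quad_form ?V (part_defect k v)" for v
        unfolding quad_form_scale[symmetric] quad_form_add[symmetric]
        by (rule quad_form_cong) (simp add: Q_def part_defect_def graph_mat_def all_ones_def algebra_simps)
      have pQ: "p * quad_form ?V ?M = (\<Sum>v\<in>?T. var v * quad_form ?V (\<lambda>i j. w * Q v i j)) +
          const_poly (w * real k) * (\<Sum>v\<in>?T. var v * quad_form ?V (part_defect k v))"
        unfolding pM sum_distrib_left sum.distrib[symmetric]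
        by (intro sum.cong refl) (subst split, simp add: algebra_simps)
      have "p * quad_form ?V ?M - (\<Sum>v\<in>?V. var v * quad_form ?V (R v)) =
          const_poly (w * real k) * (\<Sum>v\<in>?T. var v * quad_form ?V (part_defect k v))"
        unfolding R_sum pQ by (rule add_diff_cancel_left')
      moreover have "nonneg_coefs (\<Sum>v\<in>?T. var v * quad_form ?V (part_defect k v))"
      proof (rule nonneg_coefs_symmetrized_cubic[OF V TV])
        show "part_defect k v i j = part_defect k v j i" for v i j
          by (simp add: part_defect_def adj_mat_def id_mat_def insert_commute eq_commute)
      qed (use part_defect_same part_defect_mixed in auto)
      ultimately show "nonneg_coefs (p * quad_form ?V ?M - (\<Sum>v\<in>?V. var v * quad_form ?V (R v)))"
        using w by (simp add: nonneg_coefs_mult nonneg_coefs_const)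
    qed
  qed
  ultimately show ?thesis
    unfolding cone_Q_tilde_def using sym_graph_mat by blast
qed

text \<open>
  The certificate of order 1 makes \<open>k (A + I) - J\<close> copositive, which bounds the size of stable sets by \<open>k\<close>.
\<close>

lemma alpha_L_graph:
  assumes k: "k \<ge> 2"
  shows "alpha (L_graph k) = k"
proof (rule antisym)
  obtain S where S: "stable (L_graph k) S" "card S = alpha (L_graph k)"
    using alpha_attained[OF simple_graph_L_graph] .
  show "alpha (L_graph k) \<le> k"
  proof (cases "S = {}")
    case False
    then have "real (card S) \<le> real k"
      by (rule cone_Q_tilde_imp_stable_le[OF simple_graph_L_graph L_graph_mat_in_cone_Q_tilde_1[OF k] S(1)])
    then show ?thesis using S by simp
  qed (use S in simp)
  have "stable (L_graph k) (VS ` {1..k})"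
    by (auto simp: stable_def L_edge_iff verts_L_graph)
  from stable_le_alpha[OF simple_graph_L_graph this] show "k \<le> alpha (L_graph k)"
    by (simp add: card_image inj_on_def)
qed

section \<open>The ranks\<close>

theorem theorem6p5:
  fixes k :: nat
  assumes "k \<ge> 2"
  shows "nu_rank (L_graph k) \<ge> enat (alpha (L_graph k) - 1)
    \<and> nu (alpha (L_graph k) - 2) (L_graph k) > real (alpha (L_graph k))
    \<and> nu_tilde_rank (L_graph k) = 1"
proof -
  let ?G = "L_graph k"
  have G: "simple_graph ?G" by (rule simple_graph_L_graph)
  have \<alpha>: "alpha ?G = k" by (rule alpha_L_graph[OF assms])
  have ne: "verts ?G \<noteq> {}" using assms by (auto simp: verts_L_graph)
  have nu: "real k < nu r ?G" if "r + 2 \<le> k" for r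
    using alpha_less_nu[OF G ne] L_graph_mat_notin_cone_Q[OF that] by (simp add: \<alpha>)
  have "enat (k - 1) \<le> nu_rank ?G"
    unfolding nu_rank_def
  proof (rule Inf_greatest)
    fix x assume "x \<in> {enat r | r. nu r ?G = real (alpha ?G)}"
    then obtain r where r: "x = enat r" "nu r ?G = real k" using \<alpha> by auto
    then have "\<not> r + 2 \<le> k" using nu[of r] by auto
    then show "enat (k - 1) \<le> x" using r by simp
  qed
  moreover have "nu_tilde_rank ?G = 1"
  proof -
    have "nu_tilde 1 ?G = real k"
      unfolding nu_tilde_def
    proof (rule Least_equality)
      show "graph_mat (real k) ?G \<in> cone_Q_tilde (verts ?G) 1"
        by (rule L_graph_mat_in_cone_Q_tilde_1[OF assms])
      obtain S where S: "stable ?G S" "card S = alpha ?G" using alpha_attained[OF G] .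
      moreover have "S \<noteq> {}" using S assms \<alpha> by auto
      ultimately show "real k \<le> t" if "graph_mat t ?G \<in> cone_Q_tilde (verts ?G) 1" for t
        using cone_Q_tilde_imp_stable_le[OF G that] \<alpha> by metis
    qed
    then have "enat 1 \<in> {enat r | r. nu_tilde r ?G = real (alpha ?G)}" by (auto simp: \<alpha>)
    then have "nu_tilde_rank ?G \<le> enat 1"
      unfolding nu_tilde_rank_def by (rule Inf_lower)
    moreover have "enat 1 \<le> nu_tilde_rank ?G"
      unfolding nu_tilde_rank_def
    proof (rule Inf_greatest)
      fix x assume "x \<in> {enat r | r. nu_tilde r ?G = real (alpha ?G)}"
      then obtain r where r: "x = enat r" "nu_tilde r ?G = real k" using \<alpha> by auto
      moreover have "nu_tilde 0 ?G \<noteq> real k" using nu[of 0] assms by (simp add: nu_tilde_0)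
      ultimately have "r \<noteq> 0" by metis
      then show "enat 1 \<le> x" using r by simp
    qed
    ultimately show ?thesis by (simp add: one_enat_def)
  qed
  moreover have "real k < nu (k - 2) ?G" using assms by (intro nu) simp
  ultimately show ?thesis by (simp add: \<alpha>)
qed

end
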